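(* Consider the linear-quadratic McKean-Vlasov control problem described in the context, and assume: (c0) $Q\ge0$, $Q+\bar Q\ge0$, and for all $k=0,\ldots,n-1$: $Q_k\ge0$, $Q_k+\bar Q_k\ge0$, $R_k\ge0$, $R_k+\bar R_k\ge0$; and for all $k=0,\ldots,n-1$ (with the convention $Q_n=Q$, $\bar Q_n=\bar Q$): (c1) $R_k>0$, or [$\mathrm{rank}(C_k)=d$ and $Q_{k+1}>0$], or [$\mathrm{rank}(H_k)=d$ and $Q_{k+1}>0$]; (c2) $R_k+\bar R_k>0$, or [$\mathrm{rank}(C_k+\bar C_k)=d$ and $Q_{k+1}+\bar Q_{k+1}>0$], or [$\mathrm{rank}(H_k+\bar H_k)=d$ and $Q_{k+1}>0$]. Define by backward induction $\Lambda_n=Q$, $\Gamma_n=Q+\bar Q$, $\rho_n=L+\bar L$, $\chi_n=0$, and for $k=n-1,\ldots,0$: $$\begin{aligned} V_k&=R_k+H_k^{\top}\Lambda_{k+1}H_k+C_k^{\top}\Lambda_{k+1}C_k,\\ W_k&=R_k+\bar R_k+(C_k+\bar C_k)^{\top}\Gamma_{k+1}(C_k+\bar C_k)+(H_k+\bar H_k)^{\top}\Lambda_{k+1}(H_k+\bar H_k),\\ S_k&=D_k^{\top}\Lambda_{k+1}H_k+B_k^{\top}\Lambda_{k+1}C_k,\\ T_k&=(D_k+\bar D_k)^{\top}\Lambda_{k+1}(H_k+\bar H_k)+(B_k+\bar B_k)^{\top}\Gamma_{k+1}(C_k+\bar C_k),\\ \Lambda_k&=Q_k+B_k^{\top}\Lambda_{k+1}B_k+D_k^{\top}\Lambda_{k+1}D_k-S_kV_k^{-1}S_k^{\top},\\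 \Gamma_k&=Q_k+\bar Q_k+(B_k+\bar B_k)^{\top}\Gamma_{k+1}(B_k+\bar B_k)+(D_k+\bar D_k)^{\top}\Lambda_{k+1}(D_k+\bar D_k)-T_kW_k^{-1}T_k^{\top},\\ \rho_k&=L_k+\bar L_k+\big[(B_k+\bar B_k)-(C_k+\bar C_k)W_k^{-1}T_k^{\top}\big]^{\top}\rho_{k+1},\\ \chi_k&=\chi_{k+1}-\tfrac14\,\rho_{k+1}^{\top}(C_k+\bar C_k)W_k^{-1}(C_k+\bar C_k)^{\top}\rho_{k+1}. \end{aligned}$$ Then, for all $k=1,\ldots,n$, the matrices $V_{k-1}$, $W_{k-1}$ are symmetric positive, hence invertible, and $\Lambda_k,\Gamma_k$ are symmetric nonnegative; the value functions are $$v_k(\mu)=\mathrm{Var}(\mu)(\Lambda_k)+\bar\mu^{\top}\Gamma_k\bar\mu+\rho_k^{\top}\bar\mu+\chi_k,\qquad k=0,\ldots,n,\ \mu\in\mathcal{P}_2(\mathbb{R}^d);$$ and the optimal control $\alpha^*$ (i.e. $J(\alpha^* )=\inf_{\alpha\in\mathcal{A}}J(\alpha)$) is given in feedback form, with $X^*=X^{\alpha^*}$, by $$\alpha_k^*=-V_k^{-1}S_k^{\top}\big(X_k^*-\mathbb{E}[X_k^*]\big)-W_k^{-1}T_k^{\top}\mathbb{E}[X_k^*],\quad k=0,\ldots,n-1.$$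
   Context: State space $E=\mathbb{R}^d$, control space $A=\mathbb{R}^m$, horizon $n\ge1$. For symmetric matrices, $M\ge0$ (nonnegative) means positive semidefinite and $M>0$ (positive) means positive definite. $A^E$ is the set of measurable functions $\tilde\alpha:\mathbb{R}^d\to\mathbb{R}^m$ with linear growth, and $\mathcal{A}$ is the set of feedback controls, i.e. sequences $(\tilde\alpha_k)_k$ in $A^E$ with $\alpha_k=\tilde\alpha_k(X_k^\alpha)$ (the function $\tilde\alpha_k$ may be chosen depending on the deterministic law of $X_k^\alpha$). Dynamics: $X_0^\alpha=\xi$ and, for $k=0,\ldots,n-1$, $$X_{k+1}^\alpha=B_kX_k^\alpha+\bar B_k\mathbb{E}[X_k^\alpha]+C_k\alpha_k+\bar C_k\mathbb{E}[\alpha_k]+\big(D_kX_k^\alpha+\bar D_k\mathbb{E}[X_k^\alpha]+H_k\alpha_k+\bar H_k\mathbb{E}[\alpha_k]\big)\varepsilon_{k+1},$$ where $B_k,\bar B_k,D_k,\bar D_k\in\mathbb{R}^{d\times d}$, $C_k,\bar C_k,H_k,\bar H_k\in\mathbb{R}^{d\times m}$ are constant matrices, $(\varepsilon_k)$ are i.i.d. real random variables with law $\mathcal{N}(0,1)$, independent of the square integrable $\mathbb{R}^d$-valued random variable $\xi$. Cost to be minimized: $$J(\alpha)=\mathbb{E}\Big[\sum_{k=0}^{n-1}\big((X_k^\alpha)^{\top}Q_kX_k^\alpha+\mathbb{E}[X_k^\alpha]^{\top}\bar Q_k\mathbb{E}[X_k^\alpha]+L_k^{\top}X_k^\alpha+\bar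 L_k^{\top}\mathbb{E}[X_k^\alpha]+\alpha_k^{\top}R_k\alpha_k+\mathbb{E}[\alpha_k]^{\top}\bar R_k\mathbb{E}[\alpha_k]\big)$$ $$\qquad+(X_n^\alpha)^{\top}QX_n^\alpha+\mathbb{E}[X_n^\alpha]^{\top}\bar Q\,\mathbb{E}[X_n^\alpha]+L^{\top}X_n^\alpha+\bar L^{\top}\mathbb{E}[X_n^\alpha]\Big],$$ with $Q_k,\bar Q_k,Q,\bar Q\in\mathbb{R}^{d\times d}$ and $R_k,\bar R_k\in\mathbb{R}^{m\times m}$ symmetric, $L_k,\bar L_k,L,\bar L\in\mathbb{R}^d$. Notation: $\mathcal{P}_2$ denotes the set of probability measures with finite second moment; for $\mu\in\mathcal{P}_2(\mathbb{R}^d)$ (or $\mathcal{P}_2(\mathbb{R}^m)$) and a symmetric matrix $\Lambda$ of matching size, $\bar\mu:=\int x\,\mu(dx)$ and $\mathrm{Var}(\mu)(\Lambda):=\int x^{\top}\Lambda x\,\mu(dx)-\bar\mu^{\top}\Lambda\bar\mu$. $\tilde\alpha\star\mu$ is the image of $\mu$ by $\tilde\alpha$, and $\overline{\tilde\alpha\star\mu}$ its mean. Value functions: $v_0,\ldots,v_n$ on $\mathcal{P}_2(\mathbb{R}^d)$ are defined by $v_n=\hat g$ and $v_k(\mu)=\inf_{\tilde\alpha\in A^E}\big[\hat f_k(\mu,\tilde\alpha)+v_{k+1}(\Phi_{k+1}(\mu,\tilde\alpha))\big]$, $k=0,\ldots,n-1$, where $\hat f_k(\mu,\tilde\alpha)=\mathrm{Var}(\mu)(Q_k)+\bar\mu^{\top}(Q_k+\bar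 Q_k)\bar\mu+(L_k+\bar L_k)^{\top}\bar\mu+\mathrm{Var}(\tilde\alpha\star\mu)(R_k)+\overline{\tilde\alpha\star\mu}^{\top}(R_k+\bar R_k)\overline{\tilde\alpha\star\mu}$, $\hat g(\mu)=\mathrm{Var}(\mu)(Q)+\bar\mu^{\top}(Q+\bar Q)\bar\mu+(L+\bar L)^{\top}\bar\mu$, and $\Phi_{k+1}(\mu,\tilde\alpha)$ is the law of $B_kY+\bar B_k\bar\mu+C_k\tilde\alpha(Y)+\bar C_k\overline{\tilde\alpha\star\mu}+(D_kY+\bar D_k\bar\mu+H_k\tilde\alpha(Y)+\bar H_k\overline{\tilde\alpha\star\mu})\varepsilon$ with $Y\sim\mu$ and $\varepsilon\sim\mathcal{N}(0,1)$ independent.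
   Formalization: In (c1), (c2) each condition rank = d is replaced by rank = m (for m > d the printed one allows singular V_k, W_k), and the optimal control has the extra term -(1/2) W_k^{-1}(C_k + \bar C_k)^T rho_{k+1}, without which it is not optimal when linear costs matter. *)

theory Defs
  imports "HOL-Probability.Probability"
begin

text \<open>
  Coefficients of the linear-quadratic McKean-Vlasov problem with state space \<open>\<real>\<^sup>d\<close> and
  control space \<open>\<real>\<^sup>m\<close>; a \<open>d \<times> m\<close> matrix has type \<open>real^'m^'d\<close>.
  With horizon \<open>n\<close>, the terminal coefficients \<open>Q, Q', L, L'\<close> are stored at index \<open>n\<close> of
  \<open>Qm, Qbar, Lv, Lbar\<close>; all other coefficients are only read at indices \<open>k < n\<close>.
\<close>

record ('d, 'm) lq_data =
  Bm :: "nat \<Rightarrow> real^('d::finite)^'d"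
  Bbar :: "nat \<Rightarrow> real^'d^'d"
  Cm :: "nat \<Rightarrow> real^('m::finite)^'d"
  Cbar :: "nat \<Rightarrow> real^'m^'d"
  Dm :: "nat \<Rightarrow> real^'d^'d"
  Dbar :: "nat \<Rightarrow> real^'d^'d"
  Hm :: "nat \<Rightarrow> real^'m^'d"
  Hbar :: "nat \<Rightarrow> real^'m^'d"
  Qm :: "nat \<Rightarrow> real^'d^'d"
  Qbar :: "nat \<Rightarrow> real^'d^'d"
  Lv :: "nat \<Rightarrow> real^'d"
  Lbar :: "nat \<Rightarrow> real^'d"
  Rm :: "nat \<Rightarrow> real^'m^'m"
  Rbar :: "nat \<Rightarrow> real^'m^'m"

definition symmetric_mat :: "real^'k^'k \<Rightarrow> bool" where
  "symmetric_mat A \<longleftrightarrow> transpose A = A"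

definition nonneg_mat :: "real^'k^'k \<Rightarrow> bool" where
  "nonneg_mat A \<longleftrightarrow> symmetric_mat A \<and> (\<forall>x. 0 \<le> x \<bullet> (A *v x))"

definition pos_mat :: "real^'k^'k \<Rightarrow> bool" where
  "pos_mat A \<longleftrightarrow> symmetric_mat A \<and> (\<forall>x. x \<noteq> 0 \<longrightarrow> 0 < x \<bullet> (A *v x))"

definition P2 :: "(real^'k) measure set" where
  "P2 = {\<mu>. prob_space \<mu> \<and> sets \<mu> = sets borel \<and> integrable \<mu> (\<lambda>x. (norm x)\<^sup>2)}"

definition mean :: "(real^'k) measure \<Rightarrow> real^'k" where
  "mean \<mu> = (\<integral>x. x \<partial>\<mu>)"

definition Var :: "(real^'k) measure \<Rightarrow> real^'k^'k \<Rightarrow> real" where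
  "Var \<mu> \<Lambda> = (\<integral>x. x \<bullet> (\<Lambda> *v x) \<partial>\<mu>) - mean \<mu> \<bullet> (\<Lambda> *v mean \<mu>)"

text \<open>The set \<open>A\<^sup>E\<close>.\<close>

definition lin_growth :: "(real^'d \<Rightarrow> real^'m) set" where
  "lin_growth = {a. a \<in> borel_measurable borel \<and> (\<exists>K. \<forall>x. norm (a x) \<le> K * (1 + norm x))}"

text \<open>
  Controls are identified with their feedback functions. A possible dependence of the
  function at time \<open>k\<close> on the law of the state at time \<open>k\<close> is not displayed: that law is
  deterministic and fixed by the earlier functions.
\<close>

definition feedback_controls :: "nat \<Rightarrow> (nat \<Rightarrow> real^'d \<Rightarrow> real^'m) set" where
  "feedback_controls n = {\<alpha>. \<forall>k<n. \<alpha> k \<in> lin_growth}"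

text \<open>One step of the dynamics from state \<open>x\<close> with mean \<open>xb\<close>, under control \<open>a\<close> with mean
  \<open>ab\<close> and noise \<open>e\<close>.\<close>

definition lq_step :: "('d::finite, 'm::finite) lq_data \<Rightarrow> nat \<Rightarrow>
    real^'d \<Rightarrow> real^'d \<Rightarrow> real^'m \<Rightarrow> real^'m \<Rightarrow> real \<Rightarrow> real^'d" where
  "lq_step P k x xb a ab e =
     Bm P k *v x + Bbar P k *v xb + Cm P k *v a + Cbar P k *v ab
     + e *\<^sub>R (Dm P k *v x + Dbar P k *v xb + Hm P k *v a + Hbar P k *v ab)"

definition running_cost :: "('d::finite, 'm::finite) lq_data \<Rightarrow> nat \<Rightarrow>
    real^'d \<Rightarrow> real^'d \<Rightarrow> real^'m \<Rightarrow> real^'m \<Rightarrow> real" where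
  "running_cost P k x xb a ab =
     x \<bullet> (Qm P k *v x) + xb \<bullet> (Qbar P k *v xb) + Lv P k \<bullet> x + Lbar P k \<bullet> xb
     + a \<bullet> (Rm P k *v a) + ab \<bullet> (Rbar P k *v ab)"

definition terminal_cost :: "('d::finite, 'm::finite) lq_data \<Rightarrow> nat \<Rightarrow>
    real^'d \<Rightarrow> real^'d \<Rightarrow> real" where
  "terminal_cost P n x xb =
     x \<bullet> (Qm P n *v x) + xb \<bullet> (Qbar P n *v xb) + Lv P n \<bullet> x + Lbar P n \<bullet> xb"

definition lq_noise :: "'w measure \<Rightarrow> nat \<Rightarrow> ('w \<Rightarrow> real^'d) \<Rightarrow> (nat \<Rightarrow> 'w \<Rightarrow> real) \<Rightarrow> bool" where
  "lq_noise M n \<xi> \<epsilon> \<longleftrightarrow>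
     prob_space M \<and>
     \<xi> \<in> borel_measurable M \<and> integrable M (\<lambda>\<omega>. (norm (\<xi> \<omega>))\<^sup>2) \<and>
     (\<forall>k\<in>{1..n}. distributed M lborel (\<epsilon> k) std_normal_density) \<and>
     prob_space.indep_vars M (\<lambda>_. borel) \<epsilon> {1..n} \<and>
     prob_space.indep_set M
       (sets (vimage_algebra (space M) \<xi> borel))
       (sets (vimage_algebra (space M) (\<lambda>\<omega>. \<lambda>k\<in>{1..n}. \<epsilon> k \<omega>) (Pi\<^sub>M {1..n} (\<lambda>_. borel))))"

primrec state :: "('d::finite, 'm::finite) lq_data \<Rightarrow> 'w measure \<Rightarrow> ('w \<Rightarrow> real^'d) \<Rightarrow>
    (nat \<Rightarrow> 'w \<Rightarrow> real) \<Rightarrow> (nat \<Rightarrow> real^'d \<Rightarrow> real^'m) \<Rightarrow> nat \<Rightarrow> 'w \<Rightarrow> real^'d" where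
  "state P M \<xi> \<epsilon> \<alpha> 0 = \<xi>"
| "state P M \<xi> \<epsilon> \<alpha> (Suc k) =
     (\<lambda>\<omega>. lq_step P k
        (state P M \<xi> \<epsilon> \<alpha> k \<omega>)
        (\<integral>\<omega>'. state P M \<xi> \<epsilon> \<alpha> k \<omega>' \<partial>M)
        (\<alpha> k (state P M \<xi> \<epsilon> \<alpha> k \<omega>))
        (\<integral>\<omega>'. \<alpha> k (state P M \<xi> \<epsilon> \<alpha> k \<omega>') \<partial>M)
        (\<epsilon> (Suc k) \<omega>))"

definition Jcost :: "('d::finite, 'm::finite) lq_data \<Rightarrow> nat \<Rightarrow> 'w measure \<Rightarrow> ('w \<Rightarrow> real^'d) \<Rightarrow>
    (nat \<Rightarrow> 'w \<Rightarrow> real) \<Rightarrow> (nat \<Rightarrow> real^'d \<Rightarrow> real^'m) \<Rightarrow> real" where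
  "Jcost P n M \<xi> \<epsilon> \<alpha> =
     (let X = state P M \<xi> \<epsilon> \<alpha> in
      \<integral>\<omega>. (\<Sum>k<n. running_cost P k (X k \<omega>) (\<integral>\<omega>'. X k \<omega>' \<partial>M)
                   (\<alpha> k (X k \<omega>)) (\<integral>\<omega>'. \<alpha> k (X k \<omega>') \<partial>M))
          + terminal_cost P n (X n \<omega>) (\<integral>\<omega>'. X n \<omega>' \<partial>M) \<partial>M)"

definition push :: "(real^'d \<Rightarrow> real^'m) \<Rightarrow> (real^'d) measure \<Rightarrow> (real^'m) measure" where
  "push a \<mu> = distr \<mu> borel a"

definition fhat :: "('d::finite, 'm::finite) lq_data \<Rightarrow> nat \<Rightarrow>
    (real^'d) measure \<Rightarrow> (real^'d \<Rightarrow> real^'m) \<Rightarrow> real" where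
  "fhat P k \<mu> a =
     Var \<mu> (Qm P k) + mean \<mu> \<bullet> ((Qm P k + Qbar P k) *v mean \<mu>) + (Lv P k + Lbar P k) \<bullet> mean \<mu>
     + Var (push a \<mu>) (Rm P k) + mean (push a \<mu>) \<bullet> ((Rm P k + Rbar P k) *v mean (push a \<mu>))"

definition ghat :: "('d::finite, 'm::finite) lq_data \<Rightarrow> nat \<Rightarrow> (real^'d) measure \<Rightarrow> real" where
  "ghat P n \<mu> =
     Var \<mu> (Qm P n) + mean \<mu> \<bullet> ((Qm P n + Qbar P n) *v mean \<mu>) + (Lv P n + Lbar P n) \<bullet> mean \<mu>"

text \<open>\<open>Phi P k\<close> is the transition from time \<open>k\<close> to time \<open>k + 1\<close>.\<close>

definition Phi :: "('d::finite, 'm::finite) lq_data \<Rightarrow> nat \<Rightarrow>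
    (real^'d) measure \<Rightarrow> (real^'d \<Rightarrow> real^'m) \<Rightarrow> (real^'d) measure" where
  "Phi P k \<mu> a =
     distr (\<mu> \<Otimes>\<^sub>M density lborel std_normal_density) borel
       (\<lambda>(y, e). lq_step P k y (mean \<mu>) (a y) (mean (push a \<mu>)) e)"

text \<open>
  Backward recursion, indexed by the number \<open>j = n - k\<close> of remaining steps. Extended reals are
  used so that the infimum is meaningful without presupposing a lower bound.
\<close>

primrec value_togo :: "('d::finite, 'm::finite) lq_data \<Rightarrow> nat \<Rightarrow> nat \<Rightarrow>
    (real^'d) measure \<Rightarrow> ereal" where
  "value_togo P n 0 = (\<lambda>\<mu>. ereal (ghat P n \<mu>))"
| "value_togo P n (Suc j) =
     (\<lambda>\<mu>. INF a\<in>lin_growth. ereal (fhat P (n - Suc j) \<mu> a) + value_togo P n j (Phi P (n - Suc j) \<mu> a))"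

definition value_fn :: "('d::finite, 'm::finite) lq_data \<Rightarrow> nat \<Rightarrow> nat \<Rightarrow>
    (real^'d) measure \<Rightarrow> ereal" where
  "value_fn P n k = value_togo P n (n - k)"

text \<open>
  Rank alternatives in the positivity conditions. With \<open>C\<close> of size \<open>d \<times> m\<close>, positivity of the
  \<open>m \<times> m\<close> matrix \<open>C\<^sup>T \<Lambda> C\<close> needs \<open>C\<close> to have rank \<open>m\<close>. The source asks for \<open>rank C = d\<close> instead:
  this is the same for \<open>m = d\<close>, never holds for \<open>m < d\<close>, and does not suffice for \<open>m > d\<close>
  (\<open>d = 1\<close>, \<open>m = 2\<close>, \<open>C = (1, 0)\<close>, \<open>H = 0\<close>, \<open>R = 0\<close>, \<open>Q = 1\<close> give the singular \<open>V = diag (1, 0)\<close>).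
\<close>

definition full_rank :: "real^'m^'d \<Rightarrow> bool" where
  "full_rank C \<longleftrightarrow> rank C = CARD('m)"

definition cond_c1 :: "('d::finite, 'm::finite) lq_data \<Rightarrow> nat \<Rightarrow> bool" where
  "cond_c1 P k \<longleftrightarrow>
     pos_mat (Rm P k)
     \<or> (full_rank (Cm P k) \<and> pos_mat (Qm P (Suc k)))
     \<or> (full_rank (Hm P k) \<and> pos_mat (Qm P (Suc k)))"

definition cond_c2 :: "('d::finite, 'm::finite) lq_data \<Rightarrow> nat \<Rightarrow> bool" where
  "cond_c2 P k \<longleftrightarrow>
     pos_mat (Rm P k + Rbar P k)
     \<or> (full_rank (Cm P k + Cbar P k) \<and> pos_mat (Qm P (Suc k) + Qbar P (Suc k)))
     \<or> (full_rank (Hm P k + Hbar P k) \<and> pos_mat (Qm P (Suc k)))"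

text \<open>
  The optimal feedback at a state \<open>x\<close> with mean \<open>xb\<close>, where \<open>r\<close> is the linear coefficient of
  the next value function. The last term comes from minimizing
  \<open>b\<^sup>T W b + 2 b\<^sup>T T\<^sup>T xb + b\<^sup>T C\<^sup>T r\<close> over the mean control \<open>b\<close>, with \<open>C\<close> here the sum \<open>Cm + Cbar\<close>.
  It is missing in the source, and vanishes when the linear costs are zero, but cannot be
  omitted in general: for \<open>d = m = n = 1\<close>, \<open>\<xi> = 0\<close>, running cost \<open>\<alpha>\<^sup>2\<close>, \<open>X\<^sub>1 = \<alpha>\<close> and terminal
  cost \<open>X\<^sub>1\<close>, the minimum of \<open>\<alpha>\<^sup>2 + \<alpha>\<close> is at \<open>-1/2\<close>, not at \<open>0\<close>.
\<close>

definition lq_feedback :: "('d::finite, 'm::finite) lq_data \<Rightarrow> nat \<Rightarrow>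
    real^'m^'m \<Rightarrow> real^'m^'m \<Rightarrow> real^'m^'d \<Rightarrow> real^'m^'d \<Rightarrow> real^'d \<Rightarrow>
    real^'d \<Rightarrow> real^'d \<Rightarrow> real^'m" where
  "lq_feedback P k V W S T r x xb =
     - ((matrix_inv V ** transpose S) *v (x - xb))
     - (matrix_inv W ** transpose T) *v xb
     - (1/2) *\<^sub>R ((matrix_inv W ** transpose (Cm P k + Cbar P k)) *v r)"

end

(*
  Subtracting means splits the problem into one for the centred state and control and one for the
  means. In both parts, adding the quadratic value function at time k + 1 to the cost at time k and
  completing the square in the control gives the quadratic value function at time k plus a square
  weighted by V k, respectively W k. The sum of these squares, the excess, is nonnegative and
  vanishes for the stated feedback. Positivity propagates backwards because the Riccati
  matrices dominate the state cost matrices. Since the law of the next state is the transition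
  Phi of the law of the current one, the total cost telescopes to the value at time 0 plus the
  excesses.
*)
theory Submission
  imports Defs
begin

text \<open>The two parts are coupled by the noise. Since it has mean 0 and variance 1, the mean of
  the noise coefficient leaves the mean of the next state unchanged but adds to its variance. It is
  therefore weighted by \<open>\<Lambda>\<close> and not by \<open>\<Gamma>\<close>, which is the
  origin of the \<open>\<Lambda>\<close> terms in \<open>W\<close>, \<open>T\<close> and
  \<open>\<Gamma>\<close>. Linear costs act on the mean only: completing the square shifts the mean
  control by a term in \<open>\<rho>\<close> and leaves the quarter in \<open>chi\<close>.

  Two obstacles shape the probabilistic half. The transition is built on a product measure, so each
  state must be independent of the next noise, while the hypotheses speak only of
  \<open>\<xi>\<close> and the noise sequence; hence the state is exhibited as a function of
  \<open>\<xi>\<close> and the past noise. Moreover the optimal feedback refers to the mean of the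
  very state that it produces; this circle is broken because the mean obeys a closed deterministic
  recursion, which is run beforehand.

  The one-step relation is an identity, so it serves both the infima over functions at a given law
  and the total cost on the sample space.\<close>

subsection \<open>Symmetric and positive matrices\<close>

lemma inner_matrix_transpose:
  fixes A :: "real^'n^'m"
  shows "x \<bullet> (A *v y) = (transpose A *v x) \<bullet> y"
  by (simp add: dot_lmul_matrix)

lemma inner_symmetric_mat:
  "symmetric_mat A \<Longrightarrow> x \<bullet> (A *v y) = y \<bullet> (A *v x)"
  using inner_matrix_transpose[of x A y]
  by (simp add: symmetric_mat_def inner_commute del: transpose_matrix_vector)

lemma symmetric_mat_add: "symmetric_mat A \<Longrightarrow> symmetric_mat B \<Longrightarrow> symmetric_mat (A + B)"
  by (simp add: symmetric_mat_def transpose_def vec_eq_iff)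

lemma symmetric_mat_diff: "symmetric_mat A \<Longrightarrow> symmetric_mat B \<Longrightarrow> symmetric_mat (A - B)"
  by (simp add: symmetric_mat_def transpose_def vec_eq_iff)

lemma symmetric_mat_congruence:
  "symmetric_mat A \<Longrightarrow> symmetric_mat (transpose C ** A ** C)"
  by (simp add: symmetric_mat_def matrix_transpose_mul matrix_mul_assoc)

lemma inner_congruence:
  fixes C :: "real^'m^'d" and D :: "real^'k^'d"
  shows "x \<bullet> ((transpose C ** A ** D) *v y) = (C *v x) \<bullet> (A *v (D *v y))"
proof -
  have "(transpose C ** A ** D) *v y = transpose C *v (A *v (D *v y))"
    by (simp only: matrix_vector_mul_assoc matrix_mul_assoc)
  then show ?thesis
    by (simp only: inner_matrix_transpose[of x "transpose C"] transpose_transpose)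
qed

lemma nonneg_mat_add: "nonneg_mat A \<Longrightarrow> nonneg_mat B \<Longrightarrow> nonneg_mat (A + B)"
  by (simp add: nonneg_mat_def symmetric_mat_add matrix_vector_mult_add_rdistrib inner_add_right)

lemma pos_nonneg_mat_add: "pos_mat A \<Longrightarrow> nonneg_mat B \<Longrightarrow> pos_mat (A + B)"
  by (simp add: nonneg_mat_def pos_mat_def symmetric_mat_add matrix_vector_mult_add_rdistrib
      inner_add_right add_pos_nonneg)

lemma nonneg_mat_congruence: "nonneg_mat A \<Longrightarrow> nonneg_mat (transpose C ** A ** C)"
  by (simp add: nonneg_mat_def symmetric_mat_congruence inner_congruence)

text \<open>Rank equal to the number of columns makes \<open>C\<close> injective, so
  \<open>A\<close> is only evaluated at nonzero vectors.\<close>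

lemma pos_mat_congruence:
  assumes "pos_mat A" "full_rank C"
  shows "pos_mat (transpose C ** A ** C)"
proof -
  have "inj ((*v) C)"
    using assms(2) by (simp add: full_rank_def full_rank_injective)
  then have "C *v x \<noteq> 0" if "x \<noteq> 0" for x
    using that injD[of "(*v) C" x 0] by auto
  then show ?thesis
    using assms(1) by (simp add: pos_mat_def symmetric_mat_congruence inner_congruence)
qed

lemma pos_mat_mono:
  assumes "pos_mat A" "symmetric_mat B" "\<And>x. x \<bullet> (A *v x) \<le> x \<bullet> (B *v x)"
  shows "pos_mat B"
  using assms unfolding pos_mat_def by (meson less_le_trans)

lemma pos_mat_imp_nonneg:
  assumes "pos_mat A"
  shows "nonneg_mat A"
proof -
  have "0 \<le> x \<bullet> (A *v x)" for x
    using assms by (cases "x = 0") (auto simp: pos_mat_def intro: less_imp_le)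
  with assms show ?thesis by (simp add: nonneg_mat_def pos_mat_def)
qed

lemma pos_mat_invertible:
  assumes "pos_mat A"
  shows "invertible A"
proof -
  have "x = 0" if "A *v x = 0" for x
  proof (rule ccontr)
    assume "x \<noteq> 0"
    with assms have "0 < x \<bullet> (A *v x)" by (simp add: pos_mat_def)
    with that show False by simp
  qed
  then show ?thesis
    by (simp add: invertible_left_inverse matrix_left_invertible_ker)
qed

lemma matrix_mul_inv:
  fixes A :: "real^'n^'n"
  assumes "invertible A"
  shows "A ** matrix_inv A = mat 1"
  using assms unfolding invertible_def matrix_inv_def by (rule someI2_ex) simp

lemma matrix_inv_cancel:
  fixes A :: "real^'n^'n"
  assumes "invertible A"
  shows "A *v (matrix_inv A *v x) = x"
  by (simp add: assms matrix_mul_inv matrix_vector_mul_assoc)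

text \<open>Transposing \<open>A ** matrix_inv A = mat 1\<close> shows that the transposed inverse
  is a left inverse of \<open>A\<close>; multiplying by \<open>matrix_inv A\<close> on the right
  identifies the two.\<close>

lemma symmetric_mat_inv:
  fixes A :: "real^'n^'n"
  assumes "symmetric_mat A" "invertible A"
  shows "symmetric_mat (matrix_inv A)"
proof -
  have "transpose (matrix_inv A) ** A = mat 1"
    using arg_cong[OF matrix_mul_inv[OF assms(2)], of transpose] assms(1)
    by (simp add: matrix_transpose_mul symmetric_mat_def)
  then have "transpose (matrix_inv A) ** (A ** matrix_inv A) = matrix_inv A"
    by (simp add: matrix_mul_assoc)
  then show ?thesis
    using assms(2) by (simp add: matrix_mul_inv symmetric_mat_def)
qed

text \<open>The factor 2 in the linear term makes \<open>- matrix_inv W *v w\<close> the centre of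
  the square.\<close>

lemma complete_square:
  assumes "symmetric_mat W" "invertible W"
  shows "b \<bullet> (W *v b) + 2 * (w \<bullet> b)
    = (b + matrix_inv W *v w) \<bullet> (W *v (b + matrix_inv W *v w)) - w \<bullet> (matrix_inv W *v w)"
proof -
  have "(matrix_inv W *v w) \<bullet> (W *v b) = b \<bullet> w"
    using inner_symmetric_mat[OF assms(1)] matrix_inv_cancel[OF assms(2)] by metis
  then show ?thesis
    by (simp add: matrix_vector_right_distrib inner_add_left inner_add_right
        matrix_inv_cancel[OF assms(2)] inner_commute)
qed

text \<open>One step of dynamic programming for a deterministic state \<open>y\<close> and control \<open>u\<close>. With the plain
  coefficients, \<open>G = \<Lambda>\<close> and \<open>r = 0\<close> it governs the centred state, with the sums of plain and barred
  coefficients it governs the mean.\<close>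

lemma riccati_step:
  fixes C H S :: "real^'m^'d" and B D :: "real^'d^'d"
  assumes V: "V = R + transpose H ** \<Lambda> ** H + transpose C ** G ** C"
    and S: "S = transpose D ** \<Lambda> ** H + transpose B ** G ** C"
    and L: "L = Q + transpose B ** G ** B + transpose D ** \<Lambda> ** D
              - S ** matrix_inv V ** transpose S"
    and sym: "symmetric_mat \<Lambda>" "symmetric_mat G" "symmetric_mat V" and inv: "invertible V"
  shows "y \<bullet> (Q *v y) + u \<bullet> (R *v u) + (D *v y + H *v u) \<bullet> (\<Lambda> *v (D *v y + H *v u))
      + (B *v y + C *v u) \<bullet> (G *v (B *v y + C *v u)) + r \<bullet> (B *v y + C *v u)
    = y \<bullet> (L *v y) + (transpose (B - C ** matrix_inv V ** transpose S) *v r) \<bullet> y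
      - 1/4 * (r \<bullet> ((C ** matrix_inv V ** transpose C) *v r))
      + (let z = u + matrix_inv V *v (transpose S *v y + (1/2) *\<^sub>R (transpose C *v r))
         in z \<bullet> (V *v z))"
proof -
  \<comment> \<open>The terms linear in \<open>u\<close> add up to
    \<open>2 * (w \<bullet> u)\<close>: the cross terms between \<open>y\<close> and
    \<open>u\<close> give \<open>S\<close>, and \<open>r\<close> enters once, hence the half.
    Expanding \<open>w \<bullet> (matrix_inv V *v w)\<close> then yields the Riccati correction, the
    correction of the linear term and the quarter.\<close>
  define w where "w = transpose S *v y + (1/2) *\<^sub>R (transpose C *v r)"
  have sq: "u \<bullet> (V *v u) + 2 * (w \<bullet> u)
    = (u + matrix_inv V *v w) \<bullet> (V *v (u + matrix_inv V *v w)) - w \<bullet> (matrix_inv V *v w)"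
    by (rule complete_square[OF sym(3) inv])
  have symI: "symmetric_mat (matrix_inv V)"
    by (rule symmetric_mat_inv[OF sym(3) inv])
  let ?s = "transpose S *v y" and ?c = "transpose C *v r"
  have "?c \<bullet> (matrix_inv V *v ?s) = ?s \<bullet> (matrix_inv V *v ?c)"
    by (rule inner_symmetric_mat[OF symI])
  then have w: "w \<bullet> (matrix_inv V *v w) = ?s \<bullet> (matrix_inv V *v ?s) + ?c \<bullet> (matrix_inv V *v ?s)
      + 1/4 * (?c \<bullet> (matrix_inv V *v ?c))"
    by (simp add: w_def matrix_vector_right_distrib inner_add_left inner_add_right
        matrix_vector_mult_scaleR field_simps del: transpose_matrix_vector)
  have wu: "w \<bullet> u = y \<bullet> (S *v u) + 1/2 * (r \<bullet> (C *v u))"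
    by (simp add: w_def inner_add_left inner_matrix_transpose del: transpose_matrix_vector)
  have Vu: "u \<bullet> (V *v u) = u \<bullet> (R *v u) + (H *v u) \<bullet> (\<Lambda> *v (H *v u)) + (C *v u) \<bullet> (G *v (C *v u))"
    by (simp add: V matrix_vector_mult_add_rdistrib inner_add_right inner_congruence)
  have Su: "y \<bullet> (S *v u) = (D *v y) \<bullet> (\<Lambda> *v (H *v u)) + (B *v y) \<bullet> (G *v (C *v u))"
    by (simp add: S matrix_vector_mult_add_rdistrib inner_add_right inner_congruence)
  have con: "x \<bullet> ((Y ** matrix_inv V ** transpose Z) *v z)
      = (transpose Y *v x) \<bullet> (matrix_inv V *v (transpose Z *v z))"
    for x z and Y Z :: "real^'m^'d"
    using inner_congruence[of x "transpose Y" "matrix_inv V" "transpose Z" z] by simp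
  have Ly: "y \<bullet> (L *v y) = y \<bullet> (Q *v y) + (B *v y) \<bullet> (G *v (B *v y)) + (D *v y) \<bullet> (\<Lambda> *v (D *v y))
      - ?s \<bullet> (matrix_inv V *v ?s)"
    by (simp add: L matrix_vector_mult_add_rdistrib matrix_vector_mult_diff_rdistrib inner_add_right
        inner_diff_right inner_congruence con del: transpose_matrix_vector)
  have ry: "(transpose (B - C ** matrix_inv V ** transpose S) *v r) \<bullet> y
      = r \<bullet> (B *v y) - ?c \<bullet> (matrix_inv V *v ?s)"
    by (simp add: inner_matrix_transpose[symmetric] matrix_vector_mult_diff_rdistrib
        inner_diff_right con del: transpose_matrix_vector)
  have "(H *v u) \<bullet> (\<Lambda> *v (D *v y)) = (D *v y) \<bullet> (\<Lambda> *v (H *v u))"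
    "(C *v u) \<bullet> (G *v (B *v y)) = (B *v y) \<bullet> (G *v (C *v u))"
    by (intro inner_symmetric_mat sym)+
  moreover have "(D *v y + H *v u) \<bullet> (\<Lambda> *v (D *v y + H *v u))
      = (D *v y) \<bullet> (\<Lambda> *v (D *v y)) + (D *v y) \<bullet> (\<Lambda> *v (H *v u))
        + (H *v u) \<bullet> (\<Lambda> *v (D *v y)) + (H *v u) \<bullet> (\<Lambda> *v (H *v u))"
    "(B *v y + C *v u) \<bullet> (G *v (B *v y + C *v u))
      = (B *v y) \<bullet> (G *v (B *v y)) + (B *v y) \<bullet> (G *v (C *v u))
        + (C *v u) \<bullet> (G *v (B *v y)) + (C *v u) \<bullet> (G *v (C *v u))"
    "r \<bullet> (B *v y + C *v u) = r \<bullet> (B *v y) + r \<bullet> (C *v u)"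
    by (simp_all add: matrix_vector_right_distrib inner_add_left inner_add_right)
  \<comment> \<open>With all inner products expanded into common atoms, the claim is linear in these
    atoms.\<close>
  ultimately show ?thesis
    using sq[unfolded w wu Vu Su]
    unfolding Let_def Ly ry con[of r C C r] w_def[symmetric]
    by argo
qed

text \<open>The subtraction in \<open>L\<close> hides its sign. By \<open>riccati_step\<close> with
  \<open>r = 0\<close>, the quadratic form of \<open>L\<close> is the least cost over
  \<open>u\<close>, a sum of nonnegative terms one of which is the form of \<open>Q\<close>.\<close>

lemma riccati_nonneg:
  fixes C H S :: "real^'m^'d" and B D :: "real^'d^'d"
  assumes V: "V = R + transpose H ** \<Lambda> ** H + transpose C ** G ** C"
    and S: "S = transpose D ** \<Lambda> ** H + transpose B ** G ** C"
    and L: "L = Q + transpose B ** G ** B + transpose D ** \<Lambda> ** D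
              - S ** matrix_inv V ** transpose S"
    and nn: "nonneg_mat \<Lambda>" "nonneg_mat G" "nonneg_mat R" "nonneg_mat Q" and V_pos: "pos_mat V"
  shows "nonneg_mat L" "y \<bullet> (Q *v y) \<le> y \<bullet> (L *v y)"
proof -
  have inv: "invertible V"
    by (rule pos_mat_invertible[OF V_pos])
  have symV: "symmetric_mat V"
    using V_pos by (simp add: pos_mat_def)
  have "symmetric_mat (S ** matrix_inv V ** transpose S)"
    using symmetric_mat_congruence[OF symmetric_mat_inv[OF symV inv], of "transpose S"] by simp
  then have sym: "symmetric_mat L"
    unfolding L using nn
    by (intro symmetric_mat_diff symmetric_mat_add symmetric_mat_congruence)
      (auto simp: nonneg_mat_def)
  show le: "y \<bullet> (Q *v y) \<le> y \<bullet> (L *v y)" for y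
  proof -
    \<comment> \<open>The minimizing control: the square in \<open>riccati_step\<close> vanishes for
      it.\<close>
    define u where "u = - (matrix_inv V *v (transpose S *v y))"
    have "y \<bullet> (L *v y) = y \<bullet> (Q *v y) + u \<bullet> (R *v u)
      + (D *v y + H *v u) \<bullet> (\<Lambda> *v (D *v y + H *v u))
      + (B *v y + C *v u) \<bullet> (G *v (B *v y + C *v u))"
      using riccati_step[OF V S L _ _ symV inv, of y u 0] nn
      by (simp add: nonneg_mat_def u_def)
    then show ?thesis
      using nn by (simp add: nonneg_mat_def)
  qed
  show "nonneg_mat L"
    using sym nn(4) le order_trans unfolding nonneg_mat_def by blast
qed

subsection \<open>Square integrable random vectors\<close>

text \<open>The measure is arbitrary because the notion is used on the sample space, on laws of the
  state, and on products of a law with the Gaussian.\<close>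

definition sq_integrable :: "'a measure \<Rightarrow> ('a \<Rightarrow> real^'k) \<Rightarrow> bool" where
  "sq_integrable N f \<longleftrightarrow> f \<in> borel_measurable N \<and> integrable N (\<lambda>x. (norm (f x))\<^sup>2)"

lemma borel_measurable_matrix_vector [measurable]:
  fixes A :: "real^'k^'l"
  shows "f \<in> borel_measurable N \<Longrightarrow> (\<lambda>x. A *v f x) \<in> borel_measurable N"
  by (rule borel_measurable_continuous_on[OF linear_continuous_on[OF matrix_vector_mul_bounded_linear]])

lemma sq_integrable_measurable: "sq_integrable N f \<Longrightarrow> f \<in> borel_measurable N"
  by (simp add: sq_integrable_def)

lemma sq_integrable_bound:
  fixes f :: "'a \<Rightarrow> real^'k"
  assumes "f \<in> borel_measurable N" "integrable N g" "\<And>x. x \<in> space N \<Longrightarrow> (norm (f x))\<^sup>2 \<le> g x"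
  shows "sq_integrable N f"
proof -
  have "integrable N (\<lambda>x. (norm (f x))\<^sup>2)"
    by (rule Bochner_Integration.integrable_bound[OF assms(2)])
      (use assms(1,3) in \<open>auto intro!: AE_I2 order_trans[OF _ abs_ge_self]\<close>)
  with assms(1) show ?thesis by (simp add: sq_integrable_def)
qed

lemma sq_integrable_add:
  assumes "sq_integrable N f" "sq_integrable N g"
  shows "sq_integrable N (\<lambda>x. f x + g x)"
proof (rule sq_integrable_bound)
  show "integrable N (\<lambda>x. 2 * (norm (f x))\<^sup>2 + 2 * (norm (g x))\<^sup>2)"
    using assms by (auto simp: sq_integrable_def)
  fix x
  have "(norm (f x + g x))\<^sup>2 \<le> (norm (f x) + norm (g x))\<^sup>2"
    by (simp add: norm_triangle_ineq power_mono)
  also have "\<dots> \<le> 2 * (norm (f x))\<^sup>2 + 2 * (norm (g x))\<^sup>2"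
    using sum_squares_bound[of "norm (f x)" "norm (g x)"] by (simp add: power2_sum)
  finally show "(norm (f x + g x))\<^sup>2 \<le> 2 * (norm (f x))\<^sup>2 + 2 * (norm (g x))\<^sup>2" .
qed (use assms in \<open>auto simp: sq_integrable_def\<close>)

lemma sq_integrable_matrix:
  fixes A :: "real^'k^'l"
  assumes "sq_integrable N f"
  shows "sq_integrable N (\<lambda>x. A *v f x)"
proof (rule sq_integrable_bound)
  show "integrable N (\<lambda>x. (onorm ((*v) A))\<^sup>2 * (norm (f x))\<^sup>2)"
    using assms by (auto simp: sq_integrable_def)
  fix x
  show "(norm (A *v f x))\<^sup>2 \<le> (onorm ((*v) A))\<^sup>2 * (norm (f x))\<^sup>2"
    unfolding power_mult_distrib[symmetric]
    by (intro power_mono onorm matrix_vector_mul_bounded_linear) simp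
qed (use assms in \<open>auto simp: sq_integrable_def\<close>)

lemma (in prob_space) sq_integrable_const: "sq_integrable M (\<lambda>_. c)"
  by (simp add: sq_integrable_def)

lemma sq_integrable_inner:
  assumes "sq_integrable N f" "sq_integrable N g"
  shows "integrable N (\<lambda>x. f x \<bullet> g x)"
proof (rule Bochner_Integration.integrable_bound)
  show "integrable N (\<lambda>x. (norm (f x))\<^sup>2 + (norm (g x))\<^sup>2)"
    using assms by (auto simp: sq_integrable_def)
  show "AE x in N. norm (f x \<bullet> g x) \<le> norm ((norm (f x))\<^sup>2 + (norm (g x))\<^sup>2)"
  proof (rule AE_I2)
    fix x
    have "\<bar>f x \<bullet> g x\<bar> \<le> norm (f x) * norm (g x)"
      by (rule Cauchy_Schwarz_ineq2)
    also have "\<dots> \<le> (norm (f x))\<^sup>2 + (norm (g x))\<^sup>2"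
      using sum_squares_bound[of "norm (f x)" "norm (g x)"]
        mult_nonneg_nonneg[OF norm_ge_zero norm_ge_zero, of "f x" "g x"] by linarith
    finally show "norm (f x \<bullet> g x) \<le> norm ((norm (f x))\<^sup>2 + (norm (g x))\<^sup>2)" by simp
  qed
qed (use assms in \<open>auto simp: sq_integrable_def\<close>)

lemma (in prob_space) sq_integrable_integrable:
  assumes "sq_integrable M f"
  shows "integrable M f"
proof (rule Bochner_Integration.integrable_bound)
  show "integrable M (\<lambda>x. 1 + (norm (f x))\<^sup>2)"
    using assms by (auto simp: sq_integrable_def)
  show "AE x in M. norm (f x) \<le> norm (1 + (norm (f x))\<^sup>2)"
  proof (rule AE_I2)
    fix x
    have "0 \<le> (norm (f x) - 1)\<^sup>2" by simp
    then show "norm (f x) \<le> norm (1 + (norm (f x))\<^sup>2)"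
      by (simp add: power2_diff) (smt (verit) norm_ge_zero)
  qed
qed (use assms in \<open>auto simp: sq_integrable_def\<close>)

lemma integral_matrix_vector:
  fixes A :: "real^'k^'l"
  assumes "integrable N f"
  shows "(\<integral>x. A *v f x \<partial>N) = A *v (\<integral>x. f x \<partial>N)"
  by (rule integral_bounded_linear[OF matrix_vector_mul_bounded_linear assms])

text \<open>The terms linear in \<open>f\<close> are kept because the uses differ: a variance takes
  \<open>c\<close> to be minus the mean, while for a centred \<open>f\<close> these terms
  vanish.\<close>

lemma (in prob_space) integral_shift_quadratic:
  assumes "sq_integrable M f"
  shows "(\<integral>x. (f x + c) \<bullet> (A *v (f x + c)) \<partial>M)
    = (\<integral>x. f x \<bullet> (A *v f x) \<partial>M) + expectation f \<bullet> (A *v c) + c \<bullet> (A *v expectation f)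
      + c \<bullet> (A *v c)"
proof -
  note f = sq_integrable_integrable[OF assms]
  note Af = sq_integrable_matrix[OF assms, of A]
  have "(\<integral>x. (f x + c) \<bullet> (A *v (f x + c)) \<partial>M)
    = (\<integral>x. f x \<bullet> (A *v f x) + f x \<bullet> (A *v c) + c \<bullet> (A *v f x) + c \<bullet> (A *v c) \<partial>M)"
    by (simp add: matrix_vector_right_distrib inner_add_left inner_add_right algebra_simps)
  also have "\<dots> = (\<integral>x. f x \<bullet> (A *v f x) \<partial>M) + (\<integral>x. f x \<bullet> (A *v c) \<partial>M)
      + (\<integral>x. c \<bullet> (A *v f x) \<partial>M) + c \<bullet> (A *v c)"
    using sq_integrable_inner[OF assms Af] f sq_integrable_integrable[OF Af]
    by (simp add: prob_space)
  finally show ?thesis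
    using f sq_integrable_integrable[OF Af] by (simp add: integral_matrix_vector)
qed

lemma (in prob_space) Var_distr:
  assumes "sq_integrable M f"
  shows "Var (distr M borel f) A
    = (\<integral>x. (f x - expectation f) \<bullet> (A *v (f x - expectation f)) \<partial>M)"
proof -
  have [measurable]: "f \<in> borel_measurable M"
    by (rule sq_integrable_measurable[OF assms])
  show ?thesis
    using integral_shift_quadratic[OF assms, of "- expectation f" A]
    by (simp add: Var_def mean_def integral_distr)
qed

lemma (in prob_space) distr_P2: "sq_integrable M f \<Longrightarrow> distr M borel f \<in> P2"
  by (simp add: P2_def prob_space_distr sq_integrable_def integrable_distr_eq)

lemma mean_distr: "f \<in> borel_measurable N \<Longrightarrow> mean (distr N borel f) = (\<integral>x. f x \<partial>N)"
  by (simp add: mean_def integral_distr)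

subsection \<open>Moments of the transition\<close>

abbreviation std_normal :: "real measure" where
  "std_normal \<equiv> density lborel std_normal_density"

lemma prob_space_std_normal: "prob_space std_normal"
  by (rule prob_space_normal_density) simp

lemma std_normal_moments:
  "integrable std_normal (\<lambda>e. e)" "(\<integral>e. e \<partial>std_normal) = 0"
  "integrable std_normal (\<lambda>e. e\<^sup>2)" "(\<integral>e. e\<^sup>2 \<partial>std_normal) = 1"
  using integrable_std_normal_moment[of 1] integral_std_normal_moment_odd[of 0]
    integrable_std_normal_moment[of 2] integral_std_normal_moment_even[of 1]
  by (simp_all add: integrable_real_density integral_real_density normal_density_nonneg)

lemma integral_prod_mult:
  fixes f :: "'a \<Rightarrow> real" and g :: "'b \<Rightarrow> real"
  assumes "prob_space N1" "prob_space N2" and f: "integrable N1 f" and g: "integrable N2 g"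
  shows "integrable (N1 \<Otimes>\<^sub>M N2) (\<lambda>(x, y). f x * g y)"
    "(\<integral>(x, y). f x * g y \<partial>(N1 \<Otimes>\<^sub>M N2)) = (\<integral>x. f x \<partial>N1) * (\<integral>y. g y \<partial>N2)"
proof -
  interpret N1: prob_space N1 by fact
  interpret N2: prob_space N2 by fact
  interpret pair_prob_space N1 N2 ..
  have [measurable]: "f \<in> borel_measurable N1" "g \<in> borel_measurable N2"
    using f g by auto
  show int: "integrable (N1 \<Otimes>\<^sub>M N2) (\<lambda>(x, y). f x * g y)"
  proof (rule Fubini_integrable)
    show "integrable N1 (\<lambda>x. \<integral>y. norm (case (x, y) of (x, y) \<Rightarrow> f x * g y) \<partial>N2)"
      using f by (simp add: abs_mult)
  qed (use g in \<open>auto\<close>)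
  show "(\<integral>(x, y). f x * g y \<partial>(N1 \<Otimes>\<^sub>M N2)) = (\<integral>x. f x \<partial>N1) * (\<integral>y. g y \<partial>N2)"
    using integral_fst'[OF int] by simp
qed

text \<open>In powers of the noise, the coefficients \<open>?f0\<close>, \<open>?f1\<close>,
  \<open>?f2\<close> meet the Gaussian moments 1, 0, 1, so the mixed products of \<open>F\<close>
  and \<open>G\<close> disappear.\<close>

lemma noisy_quadratic:
  fixes F G :: "'a \<Rightarrow> real^'k"
  assumes "prob_space N" and F: "sq_integrable N F" and G: "sq_integrable N G"
  defines "X \<equiv> \<lambda>(y, e). F y + e *\<^sub>R G y"
  shows "integrable (N \<Otimes>\<^sub>M std_normal) (\<lambda>p. X p \<bullet> (A *v X p))"
    "(\<integral>p. X p \<bullet> (A *v X p) \<partial>(N \<Otimes>\<^sub>M std_normal))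
      = (\<integral>y. F y \<bullet> (A *v F y) \<partial>N) + (\<integral>y. G y \<bullet> (A *v G y) \<partial>N)"
proof -
  interpret N: prob_space N by fact
  interpret S: prob_space std_normal by (rule prob_space_std_normal)
  note [simp] = sq_integrable_inner sq_integrable_matrix F G
  let ?f0 = "\<lambda>y. F y \<bullet> (A *v F y)" and ?f1 = "\<lambda>y. F y \<bullet> (A *v G y) + G y \<bullet> (A *v F y)"
    and ?f2 = "\<lambda>y. G y \<bullet> (A *v G y)"
  \<comment> \<open>The dummy factor 1 gives all three summands the product form of
    \<open>integral_prod_mult\<close>.\<close>
  have X: "(\<lambda>p. X p \<bullet> (A *v X p)) = (\<lambda>p. (case p of (y, e) \<Rightarrow> ?f0 y * 1)
      + (case p of (y, e) \<Rightarrow> ?f1 y * e) + (case p of (y, e) \<Rightarrow> ?f2 y * e\<^sup>2))"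
    by (auto simp: X_def matrix_vector_right_distrib inner_add_left inner_add_right
        matrix_vector_mult_scaleR power2_eq_square algebra_simps)
  note prods = integral_prod_mult[OF assms(1) prob_space_std_normal, of ?f0 "\<lambda>_. 1"]
    integral_prod_mult[OF assms(1) prob_space_std_normal, of ?f1 "\<lambda>e. e"]
    integral_prod_mult[OF assms(1) prob_space_std_normal, of ?f2 "\<lambda>e. e\<^sup>2"]
  have int: "integrable (N \<Otimes>\<^sub>M std_normal) (\<lambda>(y, e). ?f0 y * 1)"
    "integrable (N \<Otimes>\<^sub>M std_normal) (\<lambda>(y, e). ?f1 y * e)"
    "integrable (N \<Otimes>\<^sub>M std_normal) (\<lambda>(y, e). ?f2 y * e\<^sup>2)"
    by (intro prods; simp add: std_normal_moments)+
  show "integrable (N \<Otimes>\<^sub>M std_normal) (\<lambda>p. X p \<bullet> (A *v X p))"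
    unfolding X by (intro Bochner_Integration.integrable_add int)
  have "(\<integral>p. X p \<bullet> (A *v X p) \<partial>(N \<Otimes>\<^sub>M std_normal))
    = (\<integral>(y, e). ?f0 y * 1 \<partial>(N \<Otimes>\<^sub>M std_normal)) + (\<integral>(y, e). ?f1 y * e \<partial>(N \<Otimes>\<^sub>M std_normal))
      + (\<integral>(y, e). ?f2 y * e\<^sup>2 \<partial>(N \<Otimes>\<^sub>M std_normal))"
    unfolding X
    by (subst Bochner_Integration.integral_add; (intro Bochner_Integration.integrable_add int)?)+ simp
  also have "\<dots> = (\<integral>y. ?f0 y \<partial>N) + (\<integral>y. ?f2 y \<partial>N)"
    using prods(2,4,6) S.prob_space by (simp add: std_normal_moments)
  finally show "(\<integral>p. X p \<bullet> (A *v X p) \<partial>(N \<Otimes>\<^sub>M std_normal))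
      = (\<integral>y. F y \<bullet> (A *v F y) \<partial>N) + (\<integral>y. G y \<bullet> (A *v G y) \<partial>N)" .
qed

lemma sq_integrable_noisy:
  fixes F G :: "'a \<Rightarrow> real^'k"
  assumes "prob_space N" "sq_integrable N F" "sq_integrable N G"
  shows "sq_integrable (N \<Otimes>\<^sub>M std_normal) (\<lambda>(y, e). F y + e *\<^sub>R G y)"
proof -
  have [measurable]: "F \<in> borel_measurable N" "G \<in> borel_measurable N"
    using assms by (auto intro: sq_integrable_measurable)
  show ?thesis
    using noisy_quadratic(1)[OF assms, of "mat 1"]
    by (simp add: sq_integrable_def dot_square_norm)
qed

lemma noisy_mean:
  fixes F G :: "'a \<Rightarrow> real^'k"
  assumes N: "prob_space N" and F: "sq_integrable N F" and G: "sq_integrable N G"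
  shows "(\<integral>(y, e). F y + e *\<^sub>R G y \<partial>(N \<Otimes>\<^sub>M std_normal)) = (\<integral>y. F y \<partial>N)"
    (is "?I = _")
proof -
  interpret N: prob_space N by fact
  interpret S: prob_space std_normal by (rule prob_space_std_normal)
  interpret pair_prob_space N std_normal ..
  have X: "integrable (N \<Otimes>\<^sub>M std_normal) (\<lambda>(y, e). F y + e *\<^sub>R G y)"
    by (rule sq_integrable_integrable[OF sq_integrable_noisy[OF assms]])
  have int: "integrable N F" "integrable N G"
    using F G by (auto intro: N.sq_integrable_integrable)
  have "?I = (\<integral>y. (\<integral>e. F y + e *\<^sub>R G y \<partial>std_normal) \<partial>N)"
    using integral_fst'[OF X] by simp
  also have "\<dots> = (\<integral>y. F y \<partial>N)"
    using S.prob_space by (simp add: std_normal_moments)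
  finally show ?thesis .
qed

lemma lin_growth_sq_integrable:
  fixes f :: "'a \<Rightarrow> real^'d"
  assumes "prob_space N" "sq_integrable N f" "a \<in> lin_growth"
  shows "sq_integrable N (\<lambda>x. a (f x))"
proof -
  interpret prob_space N by fact
  obtain K where K: "\<And>x. norm (a x) \<le> K * (1 + norm x)" and [measurable]: "a \<in> borel_measurable borel"
    using assms(3) by (auto simp: lin_growth_def)
  have [measurable]: "f \<in> borel_measurable N" by (rule sq_integrable_measurable[OF assms(2)])
  show ?thesis
  proof (rule sq_integrable_bound)
    show "integrable N (\<lambda>x. 2 * K\<^sup>2 + 2 * K\<^sup>2 * (norm (f x))\<^sup>2)"
      using assms(2) by (simp add: sq_integrable_def)
    fix x
    have "(norm (a (f x)))\<^sup>2 \<le> (K * (1 + norm (f x)))\<^sup>2"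
      by (intro power_mono K) simp
    also have "\<dots> = K\<^sup>2 * (1 + norm (f x))\<^sup>2"
      by (simp add: power_mult_distrib)
    also have "\<dots> \<le> K\<^sup>2 * (2 + 2 * (norm (f x))\<^sup>2)"
      using sum_squares_bound[of 1 "norm (f x)"]
      by (intro mult_left_mono) (auto simp: power2_sum)
    finally show "(norm (a (f x)))\<^sup>2 \<le> 2 * K\<^sup>2 + 2 * K\<^sup>2 * (norm (f x))\<^sup>2"
      by (simp add: algebra_simps)
  qed simp
qed

lemma P2_sq_integrable:
  assumes "\<mu> \<in> P2"
  shows "prob_space \<mu>" "sq_integrable \<mu> (\<lambda>x. x)"
  using assms by (auto simp: P2_def sq_integrable_def cong: measurable_cong_sets)

lemma P2_measurable_cong:
  "\<mu> \<in> P2 \<Longrightarrow> borel_measurable \<mu> = borel_measurable borel"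
  by (auto simp: P2_def cong: measurable_cong_sets)

lemma Var_centered:
  assumes "\<mu> \<in> P2"
  shows "Var \<mu> A = (\<integral>x. (x - mean \<mu>) \<bullet> (A *v (x - mean \<mu>)) \<partial>\<mu>)"
proof -
  interpret prob_space \<mu> by (rule P2_sq_integrable[OF assms])
  show ?thesis
    using Var_distr[OF P2_sq_integrable(2)[OF assms], of A] assms
    by (simp add: distr_id2 P2_def mean_def)
qed

lemma mean_push:
  assumes "\<mu> \<in> P2" "a \<in> lin_growth"
  shows "mean (push a \<mu>) = (\<integral>x. a x \<partial>\<mu>)"
  using assms by (simp add: push_def mean_distr P2_measurable_cong lin_growth_def)

lemma P2_control_sq_integrable:
  "\<mu> \<in> P2 \<Longrightarrow> a \<in> lin_growth \<Longrightarrow> sq_integrable \<mu> a"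
  using lin_growth_sq_integrable[OF P2_sq_integrable] by blast

text \<open>Drift and noise coefficient are each split into a centred part, \<open>f\<close> or
  \<open>g\<close>, and a deterministic part. The deterministic part of the drift is the new mean;
  that of the noise coefficient, \<open>c\<close>, survives only in the variance.\<close>

lemma Phi_moments:
  fixes P :: "('d::finite, 'm::finite) lq_data" and k
  assumes \<mu>: "\<mu> \<in> P2" and a: "a \<in> lin_growth"
  defines "m \<equiv> mean \<mu>" and "b \<equiv> mean (push a \<mu>)"
  defines "c \<equiv> (Dm P k + Dbar P k) *v m + (Hm P k + Hbar P k) *v b"
    and "f \<equiv> \<lambda>y. Bm P k *v (y - m) + Cm P k *v (a y - b)"
    and "g \<equiv> \<lambda>y. Dm P k *v (y - m) + Hm P k *v (a y - b)"
  shows "Phi P k \<mu> a \<in> P2"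
    "mean (Phi P k \<mu> a) = (Bm P k + Bbar P k) *v m + (Cm P k + Cbar P k) *v b"
    "Var (Phi P k \<mu> a) A
      = (\<integral>y. f y \<bullet> (A *v f y) \<partial>\<mu>) + (\<integral>y. g y \<bullet> (A *v g y) \<partial>\<mu>) + c \<bullet> (A *v c)"
proof -
  note \<mu>_prob = P2_sq_integrable(1)[OF \<mu>]
  interpret prob_space \<mu> by (rule \<mu>_prob)
  interpret S: prob_space std_normal by (rule prob_space_std_normal)
  interpret N: pair_prob_space \<mu> std_normal ..
  note sq = P2_sq_integrable(2)[OF \<mu>] P2_control_sq_integrable[OF \<mu> a]
  note int = sq[THEN sq_integrable_integrable]
  have b: "b = expectation a" and m: "m = expectation (\<lambda>y. y)"
    by (simp_all add: b_def m_def mean_def[of \<mu>] mean_push[OF \<mu> a])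
  have csq: "sq_integrable \<mu> (\<lambda>y. y - m)" "sq_integrable \<mu> (\<lambda>y. a y - b)"
    using sq_integrable_add[OF sq(1) sq_integrable_const[of "- m"]]
      sq_integrable_add[OF sq(2) sq_integrable_const[of "- b"]] by simp_all
  note cint = csq[THEN sq_integrable_integrable]
  have fg: "sq_integrable \<mu> f" "sq_integrable \<mu> g"
    unfolding f_def g_def by (intro sq_integrable_add sq_integrable_matrix csq)+
  have zero: "expectation f = 0" "expectation g = 0"
  proof -
    have "expectation (\<lambda>y. y - m) = 0" "expectation (\<lambda>y. a y - b) = 0"
      using int by (simp_all add: prob_space b m)
    then have "expectation (\<lambda>y. A *v (y - m) + C *v (a y - b)) = 0"
      for A :: "real^'d^'d" and C :: "real^'m^'d"
      using cint sq_integrable_integrable[OF sq_integrable_matrix[OF csq(1), of A]]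
        sq_integrable_integrable[OF sq_integrable_matrix[OF csq(2), of C]]
      by (simp add: integral_matrix_vector)
    then show "expectation f = 0" "expectation g = 0"
      unfolding f_def g_def by blast+
  qed
  \<comment> \<open>Here \<open>e\<close> is the deterministic part of the drift; the noise variable
    is called \<open>u\<close> below.\<close>
  define e where "e = (Bm P k + Bbar P k) *v m + (Cm P k + Cbar P k) *v b"
  let ?X = "\<lambda>(y, u). (f y + e) + u *\<^sub>R (g y + c)"
  have step: "(\<lambda>(y, u). lq_step P k y m (a y) b u) = ?X"
    by (auto simp: lq_step_def f_def g_def e_def c_def matrix_vector_mult_add_rdistrib
        matrix_vector_mult_diff_distrib algebra_simps)
  have Phi: "Phi P k \<mu> a = distr (\<mu> \<Otimes>\<^sub>M std_normal) borel ?X"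
    by (simp only: Phi_def m_def[symmetric] b_def[symmetric] step)
  have fge: "sq_integrable \<mu> (\<lambda>y. f y + e)" "sq_integrable \<mu> (\<lambda>y. g y + c)"
    by (intro sq_integrable_add fg sq_integrable_const)+
  note X = sq_integrable_noisy[OF \<mu>_prob fge]
  show "Phi P k \<mu> a \<in> P2"
    unfolding Phi by (rule N.distr_P2[OF X])
  have EX: "(\<integral>p. ?X p \<partial>(\<mu> \<Otimes>\<^sub>M std_normal)) = e"
    using noisy_mean[OF \<mu>_prob fge] fg[THEN sq_integrable_integrable]
    by (simp add: zero prob_space)
  show "mean (Phi P k \<mu> a) = (Bm P k + Bbar P k) *v m + (Cm P k + Cbar P k) *v b"
    unfolding Phi mean_distr[OF sq_integrable_measurable[OF X]] EX by (simp add: e_def)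
  have shift: "?X p - e = (case p of (y, u) \<Rightarrow> f y + u *\<^sub>R (g y + c))" for p
    by (cases p) simp
  \<comment> \<open>Subtracting the mean \<open>e\<close> centres the drift but not the noise
    coefficient, which keeps its mean \<open>c\<close>.\<close>
  have "Var (Phi P k \<mu> a) A
      = (\<integral>y. f y \<bullet> (A *v f y) \<partial>\<mu>) + (\<integral>y. (g y + c) \<bullet> (A *v (g y + c)) \<partial>\<mu>)"
    unfolding Phi N.Var_distr[OF X] EX shift
    by (rule noisy_quadratic(2)[OF \<mu>_prob fg(1) fge(2)])
  then show "Var (Phi P k \<mu> a) A
      = (\<integral>y. f y \<bullet> (A *v f y) \<partial>\<mu>) + (\<integral>y. g y \<bullet> (A *v g y) \<partial>\<mu>) + c \<bullet> (A *v c)"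
    by (simp add: integral_shift_quadratic[OF fg(2)] zero)
qed

subsection \<open>Dynamic programming\<close>

text \<open>Coefficients and Riccati sequences without any sample space: the value functions depend
  on laws only.\<close>

locale lq_riccati =
  fixes P :: "('d::finite, 'm::finite) lq_data" and n :: nat
    and V W :: "nat \<Rightarrow> real^'m^'m" and S T :: "nat \<Rightarrow> real^'m^'d"
    and \<Lambda> \<Gamma> :: "nat \<Rightarrow> real^'d^'d" and \<rho> :: "nat \<Rightarrow> real^'d" and chi :: "nat \<Rightarrow> real"
  assumes c0_terminal: "nonneg_mat (Qm P n) \<and> nonneg_mat (Qm P n + Qbar P n)"
    and c0_running: "\<forall>k<n. nonneg_mat (Qm P k) \<and> nonneg_mat (Qm P k + Qbar P k)
                         \<and> nonneg_mat (Rm P k) \<and> nonneg_mat (Rm P k + Rbar P k)"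
    and c1: "\<forall>k<n. cond_c1 P k"
    and c2: "\<forall>k<n. cond_c2 P k"
    and \<Lambda>_n: "\<Lambda> n = Qm P n"
    and \<Gamma>_n: "\<Gamma> n = Qm P n + Qbar P n"
    and \<rho>_n: "\<rho> n = Lv P n + Lbar P n"
    and chi_n: "chi n = 0"
    and V: "\<forall>k<n. V k = Rm P k
              + transpose (Hm P k) ** \<Lambda> (Suc k) ** Hm P k
              + transpose (Cm P k) ** \<Lambda> (Suc k) ** Cm P k"
    and W: "\<forall>k<n. W k = Rm P k + Rbar P k
              + transpose (Cm P k + Cbar P k) ** \<Gamma> (Suc k) ** (Cm P k + Cbar P k)
              + transpose (Hm P k + Hbar P k) ** \<Lambda> (Suc k) ** (Hm P k + Hbar P k)"
    and S: "\<forall>k<n. S k = transpose (Dm P k) ** \<Lambda> (Suc k) ** Hm P k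
              + transpose (Bm P k) ** \<Lambda> (Suc k) ** Cm P k"
    and T: "\<forall>k<n. T k =
                transpose (Dm P k + Dbar P k) ** \<Lambda> (Suc k) ** (Hm P k + Hbar P k)
              + transpose (Bm P k + Bbar P k) ** \<Gamma> (Suc k) ** (Cm P k + Cbar P k)"
    and \<Lambda>: "\<forall>k<n. \<Lambda> k = Qm P k
              + transpose (Bm P k) ** \<Lambda> (Suc k) ** Bm P k
              + transpose (Dm P k) ** \<Lambda> (Suc k) ** Dm P k
              - S k ** matrix_inv (V k) ** transpose (S k)"
    and \<Gamma>: "\<forall>k<n. \<Gamma> k = Qm P k + Qbar P k
              + transpose (Bm P k + Bbar P k) ** \<Gamma> (Suc k) ** (Bm P k + Bbar P k)
              + transpose (Dm P k + Dbar P k) ** \<Lambda> (Suc k) ** (Dm P k + Dbar P k)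
              - T k ** matrix_inv (W k) ** transpose (T k)"
    and \<rho>: "\<forall>k<n. \<rho> k = Lv P k + Lbar P k
              + transpose ((Bm P k + Bbar P k)
                  - (Cm P k + Cbar P k) ** matrix_inv (W k) ** transpose (T k)) *v \<rho> (Suc k)"
    and chi_rec: "\<forall>k<n. chi k = chi (Suc k)
              - 1/4 * (\<rho> (Suc k) \<bullet>
                  (((Cm P k + Cbar P k) ** matrix_inv (W k) ** transpose (Cm P k + Cbar P k))
                    *v \<rho> (Suc k)))"
begin

text \<open>Matches the order of summands in the \<open>V\<close> of \<open>riccati_step\<close>,
  with \<open>\<Gamma> (Suc k)\<close> in the role of \<open>G\<close>.\<close>

lemma W_reordered:
  "k < n \<Longrightarrow> W k = (Rm P k + Rbar P k)
      + transpose (Hm P k + Hbar P k) ** \<Lambda> (Suc k) ** (Hm P k + Hbar P k)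
      + transpose (Cm P k + Cbar P k) ** \<Gamma> (Suc k) ** (Cm P k + Cbar P k)"
  using W by (simp add: add_ac)

text \<open>The invariant of the backward induction. Nonnegativity alone would not do:
  \<open>cond_c1\<close> and \<open>cond_c2\<close> assume positivity of the cost matrices at
  \<open>Suc k\<close>, whereas \<open>V k\<close> and \<open>W k\<close> are built from
  \<open>\<Lambda> (Suc k)\<close> and \<open>\<Gamma> (Suc k)\<close>.\<close>

definition dominates_running_cost :: "nat \<Rightarrow> bool" where
  "dominates_running_cost k \<longleftrightarrow> nonneg_mat (\<Lambda> k) \<and> nonneg_mat (\<Gamma> k)
    \<and> (\<forall>x. x \<bullet> (Qm P k *v x) \<le> x \<bullet> (\<Lambda> k *v x))
    \<and> (\<forall>x. x \<bullet> ((Qm P k + Qbar P k) *v x) \<le> x \<bullet> (\<Gamma> k *v x))"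

text \<open>Each alternative in \<open>cond_c1\<close> and \<open>cond_c2\<close> makes one of the
  three nonnegative summands of \<open>V k\<close> or \<open>W k\<close> positive, by domination and
  full column rank.\<close>

lemma pos_V_W:
  assumes k: "k < n" and dom: "dominates_running_cost (Suc k)"
  shows "pos_mat (V k)" "pos_mat (W k)"
proof -
  have nn: "nonneg_mat (\<Lambda> (Suc k))" "nonneg_mat (\<Gamma> (Suc k))"
    using dom by (auto simp: dominates_running_cost_def)
  have \<Lambda>_pos: "pos_mat (\<Lambda> (Suc k))" if "pos_mat (Qm P (Suc k))"
    using that dom by (auto simp: dominates_running_cost_def nonneg_mat_def intro: pos_mat_mono)
  have \<Gamma>_pos: "pos_mat (\<Gamma> (Suc k))" if "pos_mat (Qm P (Suc k) + Qbar P (Suc k))"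
    using that dom by (auto simp: dominates_running_cost_def nonneg_mat_def intro: pos_mat_mono)
  note nnc = nonneg_mat_congruence[OF nn(1)] nonneg_mat_congruence[OF nn(2)]
  have R: "nonneg_mat (Rm P k)" "nonneg_mat (Rm P k + Rbar P k)"
    using c0_running k by auto
  have pos_sum: "pos_mat (X + Y + Z)" if "nonneg_mat X" "nonneg_mat Y" "nonneg_mat Z"
    "pos_mat X \<or> pos_mat Y \<or> pos_mat Z" for X Y Z :: "real^'m^'m"
    using that pos_nonneg_mat_add[of X "Y + Z"] pos_nonneg_mat_add[of Y "X + Z"]
      pos_nonneg_mat_add[of Z "X + Y"]
    by (auto simp: nonneg_mat_add add_ac)
  show "pos_mat (V k)"
    unfolding V[rule_format, OF k]
    using c1[rule_format, OF k] \<Lambda>_pos pos_mat_congruence unfolding cond_c1_def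
    by (intro pos_sum R nnc) blast
  show "pos_mat (W k)"
    unfolding W[rule_format, OF k]
    using c2[rule_format, OF k] \<Lambda>_pos \<Gamma>_pos pos_mat_congruence unfolding cond_c2_def
    by (intro pos_sum R nnc) blast
qed

text \<open>Going down, positivity of \<open>V k\<close> and \<open>W k\<close> comes first, from
  the invariant at \<open>Suc k\<close>; only then are the inverses in \<open>\<Lambda> k\<close>
  and \<open>\<Gamma> k\<close> under control.\<close>

lemma dominates: "k \<le> n \<Longrightarrow> dominates_running_cost k"
proof (induction k rule: inc_induct)
  case base
  then show ?case
    using c0_terminal by (simp add: dominates_running_cost_def \<Lambda>_n \<Gamma>_n)
next
  case (step k)
  note k = \<open>k < n\<close>
  note pos = pos_V_W[OF k step.IH]
  have nn: "nonneg_mat (\<Lambda> (Suc k))" "nonneg_mat (\<Gamma> (Suc k))"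
    using step.IH by (auto simp: dominates_running_cost_def)
  have c0: "nonneg_mat (Qm P k)" "nonneg_mat (Qm P k + Qbar P k)"
      "nonneg_mat (Rm P k)" "nonneg_mat (Rm P k + Rbar P k)"
    using c0_running k by auto
  \<comment> \<open>For the centred part \<open>\<Lambda> (Suc k)\<close> fills both the drift and
    the noise slot; for the mean, \<open>\<Gamma> (Suc k)\<close> takes the drift slot.\<close>
  note r\<Lambda> = riccati_nonneg[OF V[rule_format, OF k] S[rule_format, OF k] \<Lambda>[rule_format, OF k]
      nn(1,1) c0(3,1) pos(1)]
  note r\<Gamma> = riccati_nonneg[OF W_reordered[OF k] T[rule_format, OF k] \<Gamma>[rule_format, OF k]
      nn(1,2) c0(4,2) pos(2)]
  show ?case
    using r\<Lambda> r\<Gamma> by (auto simp: dominates_running_cost_def)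
qed

lemma nonneg_\<Lambda>_\<Gamma>: "k \<le> n \<Longrightarrow> nonneg_mat (\<Lambda> k)" "k \<le> n \<Longrightarrow> nonneg_mat (\<Gamma> k)"
  using dominates by (auto simp: dominates_running_cost_def)

lemma V_W:
  assumes "k < n"
  shows "pos_mat (V k)" "pos_mat (W k)" "invertible (V k)" "invertible (W k)"
  using pos_V_W dominates[of "Suc k"] pos_mat_invertible assms by auto

section \<open>The one-step identity and its minimizing feedback\<close>

definition val :: "nat \<Rightarrow> (real^'d) measure \<Rightarrow> real" where
  "val k \<mu> = Var \<mu> (\<Lambda> k) + mean \<mu> \<bullet> (\<Gamma> k *v mean \<mu>) + \<rho> k \<bullet> mean \<mu> + chi k"

abbreviation mean_feedback :: "nat \<Rightarrow> real^'d \<Rightarrow> real^'m" where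
  "mean_feedback k m \<equiv> - ((matrix_inv (W k) ** transpose (T k)) *v m)
     - (1/2) *\<^sub>R ((matrix_inv (W k) ** transpose (Cm P k + Cbar P k)) *v \<rho> (Suc k))"

text \<open>The centred control \<open>a y - b\<close> and the mean control \<open>b\<close> can be
  chosen separately, so the two squares do not compete and can vanish together.\<close>

definition excess :: "nat \<Rightarrow> (real^'d) measure \<Rightarrow> (real^'d \<Rightarrow> real^'m) \<Rightarrow> real" where
  "excess k \<mu> a =
     (let m = mean \<mu>; b = mean (push a \<mu>);
          z = \<lambda>y. a y - b + (matrix_inv (V k) ** transpose (S k)) *v (y - m)
      in (\<integral>y. z y \<bullet> (V k *v z y) \<partial>\<mu>)
         + (b - mean_feedback k m) \<bullet> (W k *v (b - mean_feedback k m)))"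

text \<open>\<open>riccati_step\<close> is used twice: pointwise under the integral for the centred
  variables, and once for the means.\<close>

lemma value_step:
  assumes k: "k < n" and \<mu>: "\<mu> \<in> P2" and a: "a \<in> lin_growth"
  shows "fhat P k \<mu> a + val (Suc k) (Phi P k \<mu> a) = val k \<mu> + excess k \<mu> a"
proof -
  interpret prob_space \<mu> by (rule P2_sq_integrable(1)[OF \<mu>])
  define m b where "m = mean \<mu>" and "b = mean (push a \<mu>)"
  define f g z
    where "f = (\<lambda>y. Bm P k *v (y - m) + Cm P k *v (a y - b))"
      and "g = (\<lambda>y. Dm P k *v (y - m) + Hm P k *v (a y - b))"
      and "z = (\<lambda>y. a y - b + (matrix_inv (V k) ** transpose (S k)) *v (y - m))"
  define c e where "c = (Dm P k + Dbar P k) *v m + (Hm P k + Hbar P k) *v b"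
      and "e = (Bm P k + Bbar P k) *v m + (Cm P k + Cbar P k) *v b"
  let ?L = "\<Lambda> (Suc k)" and ?G = "\<Gamma> (Suc k)"
  note defs = m_def b_def f_def g_def
  note sq = P2_sq_integrable(2)[OF \<mu>] P2_control_sq_integrable[OF \<mu> a]
  have csq: "sq_integrable \<mu> (\<lambda>y. y - m)" "sq_integrable \<mu> (\<lambda>y. a y - b)"
    using sq_integrable_add[OF sq(1) sq_integrable_const[of "- m"]]
      sq_integrable_add[OF sq(2) sq_integrable_const[of "- b"]] by simp_all
  have fgz: "sq_integrable \<mu> f" "sq_integrable \<mu> g" "sq_integrable \<mu> z"
    unfolding f_def g_def z_def by (intro sq_integrable_add sq_integrable_matrix csq)+
  have quad: "integrable \<mu> (\<lambda>y. h y \<bullet> (A *v h y))" if "sq_integrable \<mu> h"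
    for h :: "real^'d \<Rightarrow> real^'k::finite" and A
    by (intro sq_integrable_inner sq_integrable_matrix that)
  have mean_a: "b = expectation a"
    by (simp add: b_def mean_push[OF \<mu> a])
  have sym: "symmetric_mat ?L" "symmetric_mat ?G" "symmetric_mat (V k)" "symmetric_mat (W k)"
    using nonneg_\<Lambda>_\<Gamma>[of "Suc k"] V_W[OF k] k by (auto simp: nonneg_mat_def pos_mat_def)
  have "Var (push a \<mu>) (Rm P k) = (\<integral>y. (a y - b) \<bullet> (Rm P k *v (a y - b)) \<partial>\<mu>)"
    by (simp add: push_def Var_distr[OF sq(2)] mean_a)
  moreover have "Var \<mu> A = (\<integral>y. (y - m) \<bullet> (A *v (y - m)) \<partial>\<mu>)" for A
    by (simp add: Var_centered[OF \<mu>] m_def)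
  moreover have "Var (Phi P k \<mu> a) ?L
      = (\<integral>y. f y \<bullet> (?L *v f y) \<partial>\<mu>) + (\<integral>y. g y \<bullet> (?L *v g y) \<partial>\<mu>) + c \<bullet> (?L *v c)"
    unfolding defs c_def by (rule Phi_moments(3)[OF \<mu> a])
  moreover have "mean (Phi P k \<mu> a) = e"
    unfolding m_def b_def e_def by (rule Phi_moments(2)[OF \<mu> a])
  \<comment> \<open>The centred drift \<open>f\<close> and noise coefficient \<open>g\<close> both
    feed the variance of the next state, so both carry \<open>\<Lambda> (Suc k)\<close>; there is no
    linear term, hence \<open>r = 0\<close>.\<close>
  moreover have "(\<integral>y. (y - m) \<bullet> (Qm P k *v (y - m)) \<partial>\<mu>)
      + (\<integral>y. (a y - b) \<bullet> (Rm P k *v (a y - b)) \<partial>\<mu>)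
      + (\<integral>y. g y \<bullet> (?L *v g y) \<partial>\<mu>) + (\<integral>y. f y \<bullet> (?L *v f y) \<partial>\<mu>)
    = (\<integral>y. (y - m) \<bullet> (\<Lambda> k *v (y - m)) \<partial>\<mu>) + (\<integral>y. z y \<bullet> (V k *v z y) \<partial>\<mu>)" (is "?lhs = ?rhs")
  proof -
    have "?lhs = (\<integral>y. (y - m) \<bullet> (Qm P k *v (y - m)) + (a y - b) \<bullet> (Rm P k *v (a y - b))
      + g y \<bullet> (?L *v g y) + f y \<bullet> (?L *v f y) \<partial>\<mu>)"
      by (simp add: quad csq fgz)
    also have "\<dots> = (\<integral>y. (y - m) \<bullet> (\<Lambda> k *v (y - m)) + z y \<bullet> (V k *v z y) \<partial>\<mu>)"
      using riccati_step[OF V[rule_format, OF k] S[rule_format, OF k] \<Lambda>[rule_format, OF k]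
          sym(1,1,3) V_W(3)[OF k], where r = 0]
      by (intro Bochner_Integration.integral_cong refl)
        (simp add: f_def g_def z_def Let_def matrix_vector_mul_assoc[symmetric])
    also have "\<dots> = ?rhs"
      by (simp add: quad csq fgz)
    finally show ?thesis .
  qed
  \<comment> \<open>The variance \<open>c \<bullet> (?L *v c)\<close> depends on the means only and
    is charged here. The differences of \<open>\<rho>\<close> and \<open>chi\<close> are the terms
    that \<open>riccati_step\<close> produces from \<open>r\<close>.\<close>
  moreover have "m \<bullet> ((Qm P k + Qbar P k) *v m) + b \<bullet> ((Rm P k + Rbar P k) *v b)
      + c \<bullet> (?L *v c) + e \<bullet> (?G *v e) + \<rho> (Suc k) \<bullet> e
    = m \<bullet> (\<Gamma> k *v m) + (\<rho> k - Lv P k - Lbar P k) \<bullet> m + (chi k - chi (Suc k))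
      + (b - mean_feedback k m) \<bullet> (W k *v (b - mean_feedback k m))"
  proof -
    have z: "b - mean_feedback k m = b + matrix_inv (W k) *v (transpose (T k) *v m
        + (1/2) *\<^sub>R (transpose (Cm P k + Cbar P k) *v \<rho> (Suc k)))"
      by (simp add: matrix_vector_right_distrib matrix_vector_mult_scaleR
          matrix_vector_mul_assoc del: transpose_matrix_vector)
    have r: "\<rho> k - Lv P k - Lbar P k = transpose ((Bm P k + Bbar P k)
        - (Cm P k + Cbar P k) ** matrix_inv (W k) ** transpose (T k)) *v \<rho> (Suc k)"
      using \<rho>[rule_format, OF k] by simp
    have x: "chi k - chi (Suc k) = - (1/4 * (\<rho> (Suc k) \<bullet>
        (((Cm P k + Cbar P k) ** matrix_inv (W k) ** transpose (Cm P k + Cbar P k)) *v \<rho> (Suc k))))"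
      using chi_rec[rule_format, OF k] by simp
    show ?thesis
      using riccati_step[OF W_reordered[OF k] T[rule_format, OF k] \<Gamma>[rule_format, OF k]
          sym(1,2,4) V_W(4)[OF k], of m b "\<rho> (Suc k)"]
      unfolding z r x c_def e_def Let_def by linarith
  qed
  ultimately show ?thesis
    unfolding val_def fhat_def excess_def Let_def m_def[symmetric] b_def[symmetric] z_def
    by (simp add: inner_diff_left inner_add_left)
qed

lemma excess_nonneg:
  assumes "k < n" "\<mu> \<in> P2"
  shows "0 \<le> excess k \<mu> a"
proof -
  interpret prob_space \<mu> by (rule P2_sq_integrable(1)[OF assms(2)])
  have "0 \<le> x \<bullet> (V k *v x)" "0 \<le> x \<bullet> (W k *v x)" for x
    using V_W(1,2)[OF assms(1), THEN pos_mat_imp_nonneg] by (auto simp: nonneg_mat_def)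
  then show ?thesis
    unfolding excess_def Let_def by (intro add_nonneg_nonneg integral_nonneg) auto
qed

text \<open>The mean comes first as a parameter, so that \<open>feedback k m\<close> is an affine
  function of the state and lies in \<open>lin_growth\<close>.\<close>

abbreviation feedback :: "nat \<Rightarrow> real^'d \<Rightarrow> real^'d \<Rightarrow> real^'m" where
  "feedback k m x \<equiv> lq_feedback P k (V k) (W k) (S k) (T k) (\<rho> (Suc k)) x m"

lemma feedback_eq:
  "feedback k m x = mean_feedback k m - (matrix_inv (V k) ** transpose (S k)) *v (x - m)"
  by (simp add: lq_feedback_def)

lemma feedback_lin_growth: "feedback k m \<in> lin_growth"
proof -
  let ?A = "matrix_inv (V k) ** transpose (S k)"
  define c where "c = mean_feedback k m + ?A *v m"
  define K where "K = norm c + onorm ((*v) ?A)"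
  have eq: "feedback k m = (\<lambda>x. c - ?A *v x)"
    by (simp add: fun_eq_iff feedback_eq c_def matrix_vector_mult_diff_distrib)
  have "norm (c - ?A *v x) \<le> K * (1 + norm x)" for x
  proof -
    have "norm (c - ?A *v x) \<le> norm c + onorm ((*v) ?A) * norm x"
      by (rule order_trans[OF norm_triangle_ineq4])
        (simp add: onorm matrix_vector_mul_bounded_linear)
    also have "\<dots> \<le> K * (1 + norm x)"
      by (simp add: K_def algebra_simps onorm_pos_le matrix_vector_mul_bounded_linear)
    finally show ?thesis .
  qed
  moreover have "(\<lambda>x. c - ?A *v x) \<in> borel_measurable borel"
    by measurable
  ultimately show ?thesis
    unfolding lin_growth_def eq by blast
qed

text \<open>The part acting on \<open>x - mean \<mu>\<close> integrates to zero.\<close>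

lemma mean_push_feedback:
  assumes "\<mu> \<in> P2"
  shows "mean (push (feedback k (mean \<mu>)) \<mu>) = mean_feedback k (mean \<mu>)"
proof -
  interpret prob_space \<mu> by (rule P2_sq_integrable(1)[OF assms])
  have int: "integrable \<mu> (\<lambda>x. x)"
    by (rule sq_integrable_integrable[OF P2_sq_integrable(2)[OF assms]])
  have "integrable \<mu> (\<lambda>x. x - mean \<mu>)" "(\<integral>x. x - mean \<mu> \<partial>\<mu>) = 0"
    using int by (simp_all add: prob_space mean_def)
  moreover from this have "integrable \<mu> (\<lambda>x. A *v (x - mean \<mu>))" for A :: "real^'d^'m"
    by (intro integrable_bounded_linear[OF matrix_vector_mul_bounded_linear])
  ultimately show ?thesis
    unfolding mean_push[OF assms feedback_lin_growth]
    by (simp add: feedback_eq integral_matrix_vector prob_space del: transpose_matrix_vector)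
qed

lemma excess_feedback:
  assumes "\<mu> \<in> P2"
  shows "excess k \<mu> (feedback k (mean \<mu>)) = 0"
  unfolding excess_def Let_def mean_push_feedback[OF assms] by (simp add: feedback_eq)

lemma val_terminal: "val n \<mu> = ghat P n \<mu>"
  by (simp add: val_def ghat_def \<Lambda>_n \<Gamma>_n \<rho>_n chi_n)

text \<open>By \<open>value_step\<close> the infimum runs over \<open>val k \<mu>\<close> plus the
  excess, and it is attained at the feedback whose parameter is the mean of \<open>\<mu>\<close>
  itself.\<close>

lemma value_togo_eq: "j \<le> n \<Longrightarrow> \<mu> \<in> P2 \<Longrightarrow> value_togo P n j \<mu> = ereal (val (n - j) \<mu>)"
proof (induction j arbitrary: \<mu>)
  case 0
  then show ?case by (simp add: val_terminal)
next
  case (Suc j)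
  define k where "k = n - Suc j"
  have k: "k < n" "n - j = Suc k"
    using Suc.prems by (auto simp: k_def)
  have "value_togo P n (Suc j) \<mu>
      = (INF a\<in>lin_growth. ereal (fhat P k \<mu> a) + value_togo P n j (Phi P k \<mu> a))"
    by (simp add: k_def)
  also have "\<dots> = (INF a\<in>lin_growth. ereal (val k \<mu> + excess k \<mu> a))"
    using Suc k by (intro INF_cong refl) (simp add: Phi_moments(1) value_step)
  also have "\<dots> = ereal (val k \<mu>)"
  proof (rule antisym)
    show "(INF a\<in>lin_growth. ereal (val k \<mu> + excess k \<mu> a)) \<le> ereal (val k \<mu>)"
      using feedback_lin_growth[of k "mean \<mu>"] excess_feedback[OF Suc.prems(2), of k]
      by (intro INF_lower2) auto
    show "ereal (val k \<mu>) \<le> (INF a\<in>lin_growth. ereal (val k \<mu> + excess k \<mu> a))"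
      using excess_nonneg[OF k(1) Suc.prems(2)] by (intro INF_greatest) simp
  qed
  finally show ?case by (simp add: k_def)
qed

end

subsection \<open>Law of the controlled state\<close>

text \<open>The library's \<^term>\<open>prob_space.indep_var\<close> forces both variables to have the same range type.\<close>

definition (in prob_space) indep_rv ::
    "'b measure \<Rightarrow> ('a \<Rightarrow> 'b) \<Rightarrow> 'c measure \<Rightarrow> ('a \<Rightarrow> 'c) \<Rightarrow> bool" where
  "indep_rv S X T Y \<longleftrightarrow> random_variable S X \<and> random_variable T Y \<and>
     indep_set {X -` a \<inter> space M |a. a \<in> sets S} {Y -` b \<inter> space M |b. b \<in> sets T}"

lemma (in prob_space) indep_rvI:
  assumes "random_variable S X" "random_variable T Y"
    and "\<And>a b. a \<in> sets S \<Longrightarrow> b \<in> sets T \<Longrightarrow>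
      prob ((X -` a \<inter> space M) \<inter> (Y -` b \<inter> space M))
        = prob (X -` a \<inter> space M) * prob (Y -` b \<inter> space M)"
  shows "indep_rv S X T Y"
  using assms unfolding indep_rv_def indep_sets2_eq by auto

lemma (in prob_space) indep_rvD:
  assumes "indep_rv S X T Y" "a \<in> sets S" "b \<in> sets T"
  shows "prob ((X -` a \<inter> space M) \<inter> (Y -` b \<inter> space M))
    = prob (X -` a \<inter> space M) * prob (Y -` b \<inter> space M)"
  using assms unfolding indep_rv_def by (blast intro: indep_setD)

lemma (in prob_space) indep_rv_compose:
  assumes ind: "indep_rv S X T Y" and f: "f \<in> measurable S S'" and g: "g \<in> measurable T T'"
  shows "indep_rv S' (\<lambda>\<omega>. f (X \<omega>)) T' (\<lambda>\<omega>. g (Y \<omega>))"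
proof (rule indep_rvI)
  have X: "random_variable S X" and Y: "random_variable T Y"
    using ind by (auto simp: indep_rv_def)
  show "random_variable S' (\<lambda>\<omega>. f (X \<omega>))" "random_variable T' (\<lambda>\<omega>. g (Y \<omega>))"
    using measurable_compose[OF X f] measurable_compose[OF Y g] by auto
  fix a b assume ab: "a \<in> sets S'" "b \<in> sets T'"
  have "(\<lambda>\<omega>. f (X \<omega>)) -` a \<inter> space M = X -` (f -` a \<inter> space S) \<inter> space M"
    "(\<lambda>\<omega>. g (Y \<omega>)) -` b \<inter> space M = Y -` (g -` b \<inter> space T) \<inter> space M"
    using measurable_space[OF X] measurable_space[OF Y] by auto
  then show "prob (((\<lambda>\<omega>. f (X \<omega>)) -` a \<inter> space M) \<inter> ((\<lambda>\<omega>. g (Y \<omega>)) -` b \<inter> space M))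
      = prob ((\<lambda>\<omega>. f (X \<omega>)) -` a \<inter> space M) * prob ((\<lambda>\<omega>. g (Y \<omega>)) -` b \<inter> space M)"
    using indep_rvD[OF ind measurable_sets[OF f ab(1)] measurable_sets[OF g ab(2)]] by simp
qed

text \<open>Links the product measure in \<open>Phi\<close> to random variables on one sample space;
  agreement on rectangles suffices.\<close>

lemma (in prob_space) indep_rv_distr:
  assumes ind: "indep_rv S X T Y"
  shows "distr M S X \<Otimes>\<^sub>M distr M T Y = distr M (S \<Otimes>\<^sub>M T) (\<lambda>\<omega>. (X \<omega>, Y \<omega>))"
proof -
  have [measurable]: "random_variable S X" "random_variable T Y"
    using ind by (auto simp: indep_rv_def)
  interpret X: prob_space "distr M S X" by (rule prob_space_distr) simp
  interpret Y: prob_space "distr M T Y" by (rule prob_space_distr) simp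
  show ?thesis
  proof (rule pair_measure_eqI)
    fix a b assume "a \<in> sets (distr M S X)" "b \<in> sets (distr M T Y)"
    then have [measurable]: "a \<in> sets S" "b \<in> sets T" by auto
    have "(\<lambda>\<omega>. (X \<omega>, Y \<omega>)) -` (a \<times> b) \<inter> space M = (X -` a \<inter> space M) \<inter> (Y -` b \<inter> space M)"
      by auto
    then show "emeasure (distr M S X) a * emeasure (distr M T Y) b
        = emeasure (distr M (S \<Otimes>\<^sub>M T) (\<lambda>\<omega>. (X \<omega>, Y \<omega>))) (a \<times> b)"
      by (simp add: emeasure_distr emeasure_eq_measure indep_rvD[OF ind] ennreal_mult)
  qed (simp_all add: X.sigma_finite_measure_axioms Y.sigma_finite_measure_axioms cong: sets_pair_measure_cong)
qed

text \<open>Regroups independence so that \<open>\<xi>\<close> joins the past noise. Probabilities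
  of triple events factor completely, and rectangles form an intersection-stable generator of the
  product sigma-algebra.\<close>

lemma (in prob_space) indep_rv_Pair:
  assumes ind: "indep_rv S X (T \<Otimes>\<^sub>M U) (\<lambda>\<omega>. (Y \<omega>, Z \<omega>))" and YZ: "indep_rv T Y U Z"
  shows "indep_rv (S \<Otimes>\<^sub>M T) (\<lambda>\<omega>. (X \<omega>, Y \<omega>)) U Z"
proof -
  have [measurable]: "random_variable S X" "random_variable T Y" "random_variable U Z"
    using ind YZ by (auto simp: indep_rv_def)
  let ?XY = "\<lambda>\<omega>. (X \<omega>, Y \<omega>)"
  let ?A = "{?XY -` C \<inter> space M |C. C \<in> {a \<times> b |a b. a \<in> sets S \<and> b \<in> sets T}}"
    and ?B = "{Z -` c \<inter> space M |c. c \<in> sets U}"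
  have XY_space: "?XY \<in> space M \<rightarrow> space S \<times> space T"
    using measurable_space[of X M S] measurable_space[of Y M T] by auto
  have genA: "{?XY -` C \<inter> space M |C. C \<in> sets (S \<Otimes>\<^sub>M T)} = sigma_sets (space M) ?A"
    unfolding sets_pair_measure by (rule sigma_sets_vimage_commute[OF XY_space])
  have genB: "?B \<subseteq> sigma_sets (space M) ?B"
    by (rule sigma_sets_superset_generator)
  have "indep_set ?A ?B"
    unfolding indep_sets2_eq
  proof (intro conjI ballI)
    show "?A \<subseteq> events" "?B \<subseteq> events" by auto
    fix u v assume "u \<in> ?A" "v \<in> ?B"
    then obtain a b c where abc [measurable]: "a \<in> sets S" "b \<in> sets T" "c \<in> sets U"
      and u: "u = ?XY -` (a \<times> b) \<inter> space M" and v: "v = Z -` c \<inter> space M"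
      by blast
    let ?a = "X -` a \<inter> space M" and ?b = "Y -` b \<inter> space M"
    \<comment> \<open>Replacing \<open>c\<close> by the whole space extracts independence of
      \<open>X\<close> and \<open>Y\<close> from the same hypothesis.\<close>
    have *: "u \<inter> v = ?a \<inter> ((\<lambda>\<omega>. (Y \<omega>, Z \<omega>)) -` (b \<times> c) \<inter> space M)"
      "u = ?a \<inter> ((\<lambda>\<omega>. (Y \<omega>, Z \<omega>)) -` (b \<times> space U) \<inter> space M)"
      "(\<lambda>\<omega>. (Y \<omega>, Z \<omega>)) -` (b \<times> c) \<inter> space M = ?b \<inter> v"
      "(\<lambda>\<omega>. (Y \<omega>, Z \<omega>)) -` (b \<times> space U) \<inter> space M = ?b"
      using measurable_space[of Z M U] by (auto simp: u v)
    have "prob (u \<inter> v) = prob ?a * prob (?b \<inter> v)"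
      using indep_rvD[OF ind abc(1), of "b \<times> c"] unfolding *(1) *(3) by simp
    moreover have "prob (?b \<inter> v) = prob ?b * prob v"
      unfolding v by (rule indep_rvD[OF YZ abc(2,3)])
    moreover have "prob u = prob ?a * prob ?b"
      using indep_rvD[OF ind abc(1), of "b \<times> space U"] unfolding *(2) *(4) by simp
    ultimately show "prob (u \<inter> v) = prob u * prob v" by simp
  qed
  moreover have "Int_stable ?A"
    unfolding Int_stable_def
  proof (intro ballI)
    fix u v assume "u \<in> ?A" "v \<in> ?A"
    then obtain a b a' b' where *: "a \<in> sets S" "b \<in> sets T" "a' \<in> sets S" "b' \<in> sets T"
      "u = ?XY -` (a \<times> b) \<inter> space M" "v = ?XY -` (a' \<times> b') \<inter> space M"
      by blast
    then have "u \<inter> v = ?XY -` ((a \<inter> a') \<times> (b \<inter> b')) \<inter> space M" by auto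
    moreover have "a \<inter> a' \<in> sets S" "b \<inter> b' \<in> sets T" using * by auto
    ultimately show "u \<inter> v \<in> ?A" by blast
  qed
  moreover have "Int_stable ?B"
    unfolding Int_stable_def
  proof (intro ballI)
    fix u v assume "u \<in> ?B" "v \<in> ?B"
    then obtain a b where *: "a \<in> sets U" "b \<in> sets U"
      "u = Z -` a \<inter> space M" "v = Z -` b \<inter> space M"
      by blast
    then have "u \<inter> v = Z -` (a \<inter> b) \<inter> space M" by auto
    moreover have "a \<inter> b \<in> sets U" using * by auto
    ultimately show "u \<inter> v \<in> ?B" by blast
  qed
  ultimately have "indep_set (sigma_sets (space M) ?A) (sigma_sets (space M) ?B)"
    by (rule indep_set_sigma_sets)
  then have "indep_set (sigma_sets (space M) ?A) ?B"
    unfolding indep_sets2_eq using genB by blast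
  moreover have "random_variable (S \<Otimes>\<^sub>M T) ?XY"
    by measurable
  ultimately show ?thesis
    unfolding indep_rv_def genA using \<open>random_variable U Z\<close> by argo
qed

lemma (in prob_space) indep_var_imp_indep_rv:
  assumes "indep_var S X T Y"
  shows "indep_rv S X T Y"
proof (rule indep_rvI)
  fix a b assume ab: "a \<in> sets S" "b \<in> sets T"
  have "(\<lambda>\<omega>. (X \<omega>, Y \<omega>)) -` (a \<times> b) \<inter> space M = (X -` a \<inter> space M) \<inter> (Y -` b \<inter> space M)"
    by auto
  with indep_varD[OF assms ab] show "prob ((X -` a \<inter> space M) \<inter> (Y -` b \<inter> space M))
      = prob (X -` a \<inter> space M) * prob (Y -` b \<inter> space M)" by simp
qed (use assms in \<open>auto dest: indep_var_rv1 indep_var_rv2\<close>)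

section \<open>The state process under a fixed control\<close>

context
  fixes P :: "('d::finite, 'm::finite) lq_data" and n :: nat and M :: "'w measure"
    and \<xi> :: "'w \<Rightarrow> real^'d" and \<epsilon> :: "nat \<Rightarrow> 'w \<Rightarrow> real" and \<alpha> :: "nat \<Rightarrow> real^'d \<Rightarrow> real^'m"
  assumes noise: "lq_noise M n \<xi> \<epsilon>" and \<alpha>: "\<alpha> \<in> feedback_controls n"
begin

interpretation prob_space M
  using noise by (simp add: lq_noise_def)

private abbreviation (input) X where "X \<equiv> state P M \<xi> \<epsilon> \<alpha>"

private abbreviation (input) past_noise where "past_noise k \<equiv> \<lambda>\<omega>. \<lambda>i\<in>{1..k}. \<epsilon> i \<omega>"

lemma measurable_\<xi>: "\<xi> \<in> borel_measurable M"
  using noise by (simp add: lq_noise_def)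

lemma measurable_\<epsilon>: "i \<in> {1..n} \<Longrightarrow> \<epsilon> i \<in> borel_measurable M"
  using noise distributed_measurable[of M lborel "\<epsilon> i" std_normal_density]
  by (auto simp: lq_noise_def)

lemma measurable_\<alpha>: "k < n \<Longrightarrow> \<alpha> k \<in> borel_measurable borel"
  using \<alpha> by (simp add: feedback_controls_def lin_growth_def)

lemma indep_\<xi>_noise: "indep_rv borel \<xi> (Pi\<^sub>M {1..n} (\<lambda>_. borel)) (past_noise n)"
proof (rule indep_rvI)
  show rv: "random_variable (Pi\<^sub>M {1..n} (\<lambda>_. borel)) (past_noise n)"
    using measurable_\<epsilon> by (intro measurable_restrict) auto
  fix a b assume ab: "a \<in> sets (borel :: (real^'d) measure)"
    "b \<in> sets (Pi\<^sub>M {1..n} (\<lambda>_. borel :: real measure))"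
  have "indep_set (sets (vimage_algebra (space M) \<xi> borel))
      (sets (vimage_algebra (space M) (past_noise n) (Pi\<^sub>M {1..n} (\<lambda>_. borel))))"
    using noise by (simp add: lq_noise_def)
  then show "prob ((\<xi> -` a \<inter> space M) \<inter> (past_noise n -` b \<inter> space M))
      = prob (\<xi> -` a \<inter> space M) * prob (past_noise n -` b \<inter> space M)"
    by (rule indep_setD) (use ab in \<open>auto intro: in_vimage_algebra\<close>)
qed (rule measurable_\<xi>)

lemma indep_past_next:
  assumes "k < n"
  shows "indep_rv (borel \<Otimes>\<^sub>M Pi\<^sub>M {1..k} (\<lambda>_. borel)) (\<lambda>\<omega>. (\<xi> \<omega>, past_noise k \<omega>))
    borel (\<epsilon> (Suc k))"
proof (rule indep_rv_Pair)
  have "indep_vars (\<lambda>_. borel) \<epsilon> {1..n}"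
    using noise by (simp add: lq_noise_def)
  \<comment> \<open>Disjoint blocks of an independent family are independent; the singleton block is
    then projected to its only coordinate.\<close>
  then have "indep_var (Pi\<^sub>M {1..k} (\<lambda>_. borel)) (past_noise k)
      (Pi\<^sub>M {Suc k} (\<lambda>_. borel)) (\<lambda>\<omega>. \<lambda>i\<in>{Suc k}. \<epsilon> i \<omega>)"
    using assms by (intro indep_var_restrict) auto
  from indep_rv_compose[OF indep_var_imp_indep_rv[OF this] measurable_id
      measurable_component_singleton[of "Suc k"]]
  show "indep_rv (Pi\<^sub>M {1..k} (\<lambda>_. borel)) (past_noise k) borel (\<epsilon> (Suc k))"
    by simp
  \<comment> \<open>Past and next noise are read off the full noise vector, whose independence of
    \<open>\<xi>\<close> is known.\<close>
  let ?f = "\<lambda>w. (restrict w {1..k}, w (Suc k))"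
  have "?f \<in> measurable (Pi\<^sub>M {1..n} (\<lambda>_. borel :: real measure))
      (Pi\<^sub>M {1..k} (\<lambda>_. borel) \<Otimes>\<^sub>M borel)"
    using assms by (intro measurable_Pair measurable_restrict_subset
        measurable_component_singleton) auto
  from indep_rv_compose[OF indep_\<xi>_noise measurable_id this]
  have "indep_rv borel \<xi> (Pi\<^sub>M {1..k} (\<lambda>_. borel) \<Otimes>\<^sub>M borel) (\<lambda>\<omega>. ?f (past_noise n \<omega>))"
    by simp
  also have "(\<lambda>\<omega>. ?f (past_noise n \<omega>)) = (\<lambda>\<omega>. (past_noise k \<omega>, \<epsilon> (Suc k) \<omega>))"
    using assms by (auto simp: fun_eq_iff restrict_def)
  finally show "indep_rv borel \<xi> (Pi\<^sub>M {1..k} (\<lambda>_. borel) \<Otimes>\<^sub>M borel)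
      (\<lambda>\<omega>. (past_noise k \<omega>, \<epsilon> (Suc k) \<omega>))" .
qed

lemma measurable_lq_step:
  assumes "f \<in> borel_measurable N" "a \<in> borel_measurable N" "e \<in> borel_measurable N"
  shows "(\<lambda>x. lq_step P k (f x) m (a x) b (e x)) \<in> borel_measurable N"
  unfolding lq_step_def using assms by measurable

text \<open>The dependence on laws does no harm: expectations enter each step as constants, so only
  \<open>\<xi>\<close> and the first \<open>k\<close> noises are random.\<close>

lemma state_function_of_noise:
  "k \<le> n \<Longrightarrow> \<exists>F \<in> borel_measurable (borel \<Otimes>\<^sub>M Pi\<^sub>M {1..k} (\<lambda>_. borel)).
     X k = (\<lambda>\<omega>. F (\<xi> \<omega>, past_noise k \<omega>))"
proof (induction k)
  case 0
  have "fst \<in> borel_measurable (borel \<Otimes>\<^sub>M Pi\<^sub>M {1..0} (\<lambda>_. borel :: real measure))"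
    by measurable
  then show ?case by (intro bexI[of _ fst]) auto
next
  case (Suc k)
  then obtain F where F: "F \<in> borel_measurable (borel \<Otimes>\<^sub>M Pi\<^sub>M {1..k} (\<lambda>_. borel))"
    and X: "X k = (\<lambda>\<omega>. F (\<xi> \<omega>, past_noise k \<omega>))"
    by (meson Suc_leD)
  let ?N = "borel \<Otimes>\<^sub>M Pi\<^sub>M {1..Suc k} (\<lambda>_. borel)"
  let ?F = "\<lambda>(x, w). F (x, restrict w {1..k})"
  define G where "G = (\<lambda>p. lq_step P k (?F p) (expectation (X k)) (\<alpha> k (?F p))
    (expectation (\<lambda>\<omega>. \<alpha> k (X k \<omega>))) (snd p (Suc k)))"
  have "(\<lambda>p. (fst p, restrict (snd p) {1..k}))
      \<in> measurable ?N (borel \<Otimes>\<^sub>M Pi\<^sub>M {1..k} (\<lambda>_. borel))"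
    by (intro measurable_Pair measurable_fst
        measurable_compose[OF measurable_snd measurable_restrict_subset]) auto
  from measurable_compose[OF this F] have F': "?F \<in> borel_measurable ?N"
    by (simp add: case_prod_beta)
  have "(\<lambda>p. snd p (Suc k)) \<in> borel_measurable ?N"
    by (intro measurable_compose[OF measurable_snd measurable_component_singleton]) auto
  moreover have "(\<lambda>p. \<alpha> k (?F p)) \<in> borel_measurable ?N"
    using measurable_compose[OF F' measurable_\<alpha>] Suc.prems by simp
  ultimately have "G \<in> borel_measurable ?N"
    unfolding G_def by (intro measurable_lq_step F')
  moreover have "restrict (past_noise (Suc k) \<omega>) {1..k} = past_noise k \<omega>" for \<omega>
    by (auto simp: restrict_def)
  then have "X (Suc k) = (\<lambda>\<omega>. G (\<xi> \<omega>, past_noise (Suc k) \<omega>))"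
    by (simp add: G_def X)
  ultimately show ?case by blast
qed

lemma indep_state_next:
  assumes "k < n"
  shows "indep_rv borel (X k) borel (\<epsilon> (Suc k))"
proof -
  obtain F where F: "F \<in> borel_measurable (borel \<Otimes>\<^sub>M Pi\<^sub>M {1..k} (\<lambda>_. borel))"
    and X: "X k = (\<lambda>\<omega>. F (\<xi> \<omega>, past_noise k \<omega>))"
    using state_function_of_noise[of k] assms by auto
  show ?thesis
    using indep_rv_compose[OF indep_past_next[OF assms] F measurable_id]
    by (simp add: X)
qed

lemma measurable_state: "k \<le> n \<Longrightarrow> X k \<in> borel_measurable M"
proof (induction k)
  case (Suc k)
  then show ?case
    using measurable_compose[OF Suc.IH measurable_\<alpha>] measurable_\<epsilon>[of "Suc k"]
    by (simp add: measurable_lq_step)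
qed (simp add: measurable_\<xi>)

private abbreviation (input) state_law where "state_law k \<equiv> distr M borel (X k)"

lemma mean_push_state_law:
  assumes "k < n"
  shows "mean (push (\<alpha> k) (state_law k)) = (\<integral>\<omega>. \<alpha> k (X k \<omega>) \<partial>M)"
  using measurable_state[of k] measurable_\<alpha>[OF assms] assms
  by (simp add: push_def mean_distr integral_distr)

text \<open>Independence of the state and the next noise turns their joint law into the product
  measure in \<open>Phi\<close>.\<close>

lemma state_law_Suc:
  assumes k: "k < n"
  shows "state_law (Suc k) = Phi P k (state_law k) (\<alpha> k)"
proof -
  let ?g = "\<lambda>(y, e). lq_step P k y (mean (state_law k)) (\<alpha> k y) (mean (push (\<alpha> k) (state_law k))) e"
  have [measurable]: "X k \<in> borel_measurable M" "\<epsilon> (Suc k) \<in> borel_measurable M"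
    "\<alpha> k \<in> borel_measurable borel"
    using measurable_state measurable_\<epsilon> measurable_\<alpha> k by auto
  have "distr M borel (\<epsilon> (Suc k)) = distr M lborel (\<epsilon> (Suc k))"
    by (rule distr_cong) auto
  also have "\<dots> = std_normal"
    using noise k by (auto simp: lq_noise_def dest: distributed_distr_eq_density)
  finally have joint: "state_law k \<Otimes>\<^sub>M std_normal
      = distr M (borel \<Otimes>\<^sub>M borel) (\<lambda>\<omega>. (X k \<omega>, \<epsilon> (Suc k) \<omega>))"
    using indep_rv_distr[OF indep_state_next[OF k]] by simp
  have g: "?g \<in> borel_measurable (borel \<Otimes>\<^sub>M borel)"
    unfolding case_prod_beta by (intro measurable_lq_step) measurable
  have "Phi P k (state_law k) (\<alpha> k) = distr M borel (\<lambda>\<omega>. ?g (X k \<omega>, \<epsilon> (Suc k) \<omega>))"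
    unfolding Phi_def joint by (subst distr_distr[OF g]) (simp_all add: comp_def)
  also have "(\<lambda>\<omega>. ?g (X k \<omega>, \<epsilon> (Suc k) \<omega>)) = X (Suc k)"
    using mean_push_state_law[OF k] by (simp add: mean_distr)
  finally show ?thesis ..
qed

lemma state_law_P2: "k \<le> n \<Longrightarrow> state_law k \<in> P2"
proof (induction k)
  case 0
  then show ?case
    using noise distr_P2[of \<xi>] by (simp add: lq_noise_def sq_integrable_def)
next
  case (Suc k)
  then show ?case
    using \<alpha> Phi_moments(1)[of "state_law k" "\<alpha> k" P k]
    by (simp add: state_law_Suc feedback_controls_def del: state.simps)
qed

lemma sq_integrable_state: "k \<le> n \<Longrightarrow> sq_integrable M (X k)"
  using state_law_P2[of k] measurable_state[of k]
  by (simp add: P2_def sq_integrable_def integrable_distr_eq)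

lemma sq_integrable_control: "k < n \<Longrightarrow> sq_integrable M (\<lambda>\<omega>. \<alpha> k (X k \<omega>))"
  by (rule lin_growth_sq_integrable[OF prob_space_axioms sq_integrable_state])
    (use \<alpha> in \<open>simp_all add: feedback_controls_def\<close>)

lemma mean_state_law: "k \<le> n \<Longrightarrow> mean (state_law k) = expectation (X k)"
  by (simp add: mean_distr measurable_state)

text \<open>A raw second moment is a variance plus a quadratic form in the mean; this moves the
  plain matrices into the mean terms of \<open>fhat\<close> and \<open>ghat\<close>.\<close>

lemma Jcost_eq_sum:
  "Jcost P n M \<xi> \<epsilon> \<alpha> = (\<Sum>k<n. fhat P k (state_law k) (\<alpha> k)) + ghat P n (state_law n)"
proof -
  define r where "r k \<omega> = running_cost P k (X k \<omega>) (expectation (X k)) (\<alpha> k (X k \<omega>))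
      (expectation (\<lambda>\<omega>'. \<alpha> k (X k \<omega>')))" for k \<omega>
  define t where "t \<omega> = terminal_cost P n (X n \<omega>) (expectation (X n))" for \<omega>
  have quad: "integrable M (\<lambda>y. h y \<bullet> (A *v h y))" if "sq_integrable M h"
    for h :: "'w \<Rightarrow> real^'k::finite" and A
    by (intro sq_integrable_inner sq_integrable_matrix that)
  have var: "Var (distr M borel h) A = expectation (\<lambda>y. h y \<bullet> (A *v h y))
      - expectation h \<bullet> (A *v expectation h)" if "sq_integrable M h"
    for h :: "'w \<Rightarrow> real^'k::finite" and A
    using sq_integrable_measurable[OF that] by (simp add: Var_def mean_distr integral_distr)
  have r: "integrable M (r k)" "expectation (r k) = fhat P k (state_law k) (\<alpha> k)" if k: "k < n" for k
  proof -
    have sq: "sq_integrable M (X k)" "sq_integrable M (\<lambda>\<omega>. \<alpha> k (X k \<omega>))"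
      using sq_integrable_state sq_integrable_control k by auto
    have push: "push (\<alpha> k) (state_law k) = distr M borel (\<lambda>\<omega>. \<alpha> k (X k \<omega>))"
      using measurable_state[of k] measurable_\<alpha>[OF k] k
      by (simp add: push_def distr_distr comp_def)
    show "integrable M (r k)" "expectation (r k) = fhat P k (state_law k) (\<alpha> k)"
      using sq[THEN sq_integrable_integrable] sq[THEN sq_integrable_measurable]
      unfolding fhat_def push var[OF sq(1)] var[OF sq(2)] r_def running_cost_def
      by (simp_all add: quad[OF sq(1)] quad[OF sq(2)] mean_distr prob_space
          matrix_vector_mult_add_rdistrib inner_add_left inner_add_right)
  qed
  have t: "integrable M t" "expectation t = ghat P n (state_law n)"
  proof -
    have sq: "sq_integrable M (X n)"
      by (rule sq_integrable_state) simp
    show "integrable M t" "expectation t = ghat P n (state_law n)"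
      using sq_integrable_integrable[OF sq] sq_integrable_measurable[OF sq]
      unfolding ghat_def var[OF sq] t_def terminal_cost_def
      by (simp_all add: quad[OF sq] mean_distr prob_space
          matrix_vector_mult_add_rdistrib inner_add_left inner_add_right)
  qed
  have "Jcost P n M \<xi> \<epsilon> \<alpha> = expectation (\<lambda>\<omega>. (\<Sum>k<n. r k \<omega>) + t \<omega>)"
    by (simp add: Jcost_def Let_def r_def t_def)
  also have "\<dots> = (\<Sum>k<n. expectation (r k)) + expectation t"
  proof -
    have "integrable M (\<lambda>\<omega>. \<Sum>k<n. r k \<omega>)"
      by (rule Bochner_Integration.integrable_sum) (simp add: r)
    then have "expectation (\<lambda>\<omega>. (\<Sum>k<n. r k \<omega>) + t \<omega>)
        = expectation (\<lambda>\<omega>. \<Sum>k<n. r k \<omega>) + expectation t"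
      by (intro Bochner_Integration.integral_add t)
    also have "expectation (\<lambda>\<omega>. \<Sum>k<n. r k \<omega>) = (\<Sum>k<n. expectation (r k))"
      by (rule Bochner_Integration.integral_sum) (simp add: r)
    finally show ?thesis .
  qed
  finally show ?thesis
    using r t by simp
qed

end

subsection \<open>Optimal control\<close>

context lq_riccati
begin

lemma Jcost_eq:
  assumes "lq_noise M n \<xi> \<epsilon>" "\<alpha> \<in> feedback_controls n"
  shows "Jcost P n M \<xi> \<epsilon> \<alpha>
    = val 0 (distr M borel \<xi>) + (\<Sum>k<n. excess k (distr M borel (state P M \<xi> \<epsilon> \<alpha> k)) (\<alpha> k))"
proof -
  let ?\<mu> = "\<lambda>k. distr M borel (state P M \<xi> \<epsilon> \<alpha> k)"
  \<comment> \<open>The cost of the first \<open>k\<close> steps with \<open>val k\<close> as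
    remainder; at \<open>k = n\<close> the remainder is the terminal cost.\<close>
  have "(\<Sum>i<k. fhat P i (?\<mu> i) (\<alpha> i)) + val k (?\<mu> k)
      = val 0 (?\<mu> 0) + (\<Sum>i<k. excess i (?\<mu> i) (\<alpha> i))" if "k \<le> n" for k
    using that
  proof (induction k)
    case (Suc k)
    have "fhat P k (?\<mu> k) (\<alpha> k) + val (Suc k) (?\<mu> (Suc k)) = val k (?\<mu> k) + excess k (?\<mu> k) (\<alpha> k)"
      using Suc.prems value_step[OF _ state_law_P2[OF assms, of k P]]
        state_law_Suc[OF assms, of k P] assms(2)
      by (simp add: feedback_controls_def del: state.simps)
    with Suc show ?case by (simp del: state.simps)
  qed simp
  from this[of n] show ?thesis
    by (simp add: Jcost_eq_sum[OF assms] val_terminal)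
qed

text \<open>Predicts the means of the optimal state before that state exists, so that the control
  can be defined without circularity.\<close>

primrec optimal_mean :: "real^'d \<Rightarrow> nat \<Rightarrow> real^'d" where
  "optimal_mean m 0 = m"
| "optimal_mean m (Suc k) = (Bm P k + Bbar P k) *v optimal_mean m k
     + (Cm P k + Cbar P k) *v mean_feedback k (optimal_mean m k)"

definition optimal_control :: "real^'d \<Rightarrow> nat \<Rightarrow> real^'d \<Rightarrow> real^'m" where
  "optimal_control m k = feedback k (optimal_mean m k)"

lemma optimal_control_feedback: "optimal_control m \<in> feedback_controls n"
  by (simp add: feedback_controls_def optimal_control_def[abs_def] feedback_lin_growth)

text \<open>Closes the circle: while the predicted mean is the true one, the control is the feedback
  at the mean of the current law, and its own mean is \<open>mean_feedback\<close>.\<close>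

lemma expectation_optimal_state:
  fixes M \<xi> \<epsilon>
  assumes noise: "lq_noise M n \<xi> \<epsilon>" and "k \<le> n"
  defines "X \<equiv> state P M \<xi> \<epsilon> (optimal_control (integral\<^sup>L M \<xi>))"
  shows "integral\<^sup>L M (X k) = optimal_mean (integral\<^sup>L M \<xi>) k"
  using \<open>k \<le> n\<close>
proof (induction k)
  case 0
  then show ?case by (simp add: X_def)
next
  case (Suc k)
  note ctx = noise optimal_control_feedback[of "integral\<^sup>L M \<xi>"]
  let ?\<mu> = "distr M borel (X k)" and ?m = "optimal_mean (integral\<^sup>L M \<xi>) k"
  have \<mu>: "?\<mu> \<in> P2" "mean ?\<mu> = ?m"
    using Suc state_law_P2[OF ctx, of k P] mean_state_law[OF ctx, of k P] by (simp_all add: X_def)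
  have "integral\<^sup>L M (X (Suc k)) = mean (distr M borel (X (Suc k)))"
    using mean_state_law[OF ctx Suc.prems, of P] unfolding X_def by (rule sym)
  also have "\<dots> = mean (Phi P k ?\<mu> (feedback k (mean ?\<mu>)))"
    using state_law_Suc[OF ctx, of k P] Suc.prems \<mu>
    by (simp add: X_def optimal_control_def[abs_def] del: state.simps)
  also have "\<dots> = (Bm P k + Bbar P k) *v ?m + (Cm P k + Cbar P k) *v mean_feedback k ?m"
    using mean_push_feedback[OF \<mu>(1)] by (simp add: Phi_moments(2)[OF \<mu>(1) feedback_lin_growth] \<mu>(2))
  finally show ?case by simp
qed

lemma optimal_control_minimizes:
  fixes M \<xi> \<epsilon>
  assumes noise: "lq_noise M n \<xi> \<epsilon>"
  shows "ereal (Jcost P n M \<xi> \<epsilon> (optimal_control (integral\<^sup>L M \<xi>)))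
    = (INF \<beta>\<in>feedback_controls n. ereal (Jcost P n M \<xi> \<epsilon> \<beta>))"
proof (rule antisym)
  let ?J = "Jcost P n M \<xi> \<epsilon>" and ?\<alpha> = "optimal_control (integral\<^sup>L M \<xi>)"
  note ctx = noise optimal_control_feedback[of "integral\<^sup>L M \<xi>"]
  have "excess k (distr M borel (state P M \<xi> \<epsilon> ?\<alpha> k)) (?\<alpha> k) = 0" if "k < n" for k
    using excess_feedback[OF state_law_P2[OF ctx, of k P], of k] that
      expectation_optimal_state[OF noise, of k] mean_state_law[OF ctx, of k P]
    by (simp add: optimal_control_def[abs_def])
  then have "?J ?\<alpha> = val 0 (distr M borel \<xi>)"
    by (simp add: Jcost_eq[OF ctx])
  also have "\<dots> \<le> ?J \<beta>" if "\<beta> \<in> feedback_controls n" for \<beta>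
    unfolding Jcost_eq[OF noise that]
    using state_law_P2[OF noise that] by (auto intro!: sum_nonneg excess_nonneg)
  finally show "ereal (?J ?\<alpha>) \<le> (INF \<beta>\<in>feedback_controls n. ereal (?J \<beta>))"
    by (intro INF_greatest) simp
  show "(INF \<beta>\<in>feedback_controls n. ereal (?J \<beta>)) \<le> ereal (?J ?\<alpha>)"
    by (intro INF_lower optimal_control_feedback)
qed

end

theorem mainTheorem3:
  fixes P :: "('d::finite, 'm::finite) lq_data"
    and n :: nat
    and M :: "'w measure"
    and \<xi> :: "'w \<Rightarrow> real^'d"
    and \<epsilon> :: "nat \<Rightarrow> 'w \<Rightarrow> real"
    and V W :: "nat \<Rightarrow> real^'m^'m"
    and S T :: "nat \<Rightarrow> real^'m^'d"
    and \<Lambda> \<Gamma> :: "nat \<Rightarrow> real^'d^'d"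
    and \<rho> :: "nat \<Rightarrow> real^'d"
    and chi :: "nat \<Rightarrow> real"
  assumes horizon: "n \<ge> 1"
    and noise: "lq_noise M n \<xi> \<epsilon>"
    and sym_Q: "\<forall>k\<le>n. symmetric_mat (Qm P k) \<and> symmetric_mat (Qbar P k)"
    and sym_R: "\<forall>k<n. symmetric_mat (Rm P k) \<and> symmetric_mat (Rbar P k)"
    and c0_terminal: "nonneg_mat (Qm P n) \<and> nonneg_mat (Qm P n + Qbar P n)"
    and c0_running: "\<forall>k<n. nonneg_mat (Qm P k) \<and> nonneg_mat (Qm P k + Qbar P k)
                         \<and> nonneg_mat (Rm P k) \<and> nonneg_mat (Rm P k + Rbar P k)"
    and c1: "\<forall>k<n. cond_c1 P k"
    and c2: "\<forall>k<n. cond_c2 P k"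
    and \<Lambda>_n: "\<Lambda> n = Qm P n"
    and \<Gamma>_n: "\<Gamma> n = Qm P n + Qbar P n"
    and \<rho>_n: "\<rho> n = Lv P n + Lbar P n"
    and chi_n: "chi n = 0"
    and V: "\<forall>k<n. V k = Rm P k
              + transpose (Hm P k) ** \<Lambda> (Suc k) ** Hm P k
              + transpose (Cm P k) ** \<Lambda> (Suc k) ** Cm P k"
    and W: "\<forall>k<n. W k = Rm P k + Rbar P k
              + transpose (Cm P k + Cbar P k) ** \<Gamma> (Suc k) ** (Cm P k + Cbar P k)
              + transpose (Hm P k + Hbar P k) ** \<Lambda> (Suc k) ** (Hm P k + Hbar P k)"
    and S: "\<forall>k<n. S k = transpose (Dm P k) ** \<Lambda> (Suc k) ** Hm P k
              + transpose (Bm P k) ** \<Lambda> (Suc k) ** Cm P k"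
    and T: "\<forall>k<n. T k =
                transpose (Dm P k + Dbar P k) ** \<Lambda> (Suc k) ** (Hm P k + Hbar P k)
              + transpose (Bm P k + Bbar P k) ** \<Gamma> (Suc k) ** (Cm P k + Cbar P k)"
    and \<Lambda>: "\<forall>k<n. \<Lambda> k = Qm P k
              + transpose (Bm P k) ** \<Lambda> (Suc k) ** Bm P k
              + transpose (Dm P k) ** \<Lambda> (Suc k) ** Dm P k
              - S k ** matrix_inv (V k) ** transpose (S k)"
    and \<Gamma>: "\<forall>k<n. \<Gamma> k = Qm P k + Qbar P k
              + transpose (Bm P k + Bbar P k) ** \<Gamma> (Suc k) ** (Bm P k + Bbar P k)
              + transpose (Dm P k + Dbar P k) ** \<Lambda> (Suc k) ** (Dm P k + Dbar P k)
              - T k ** matrix_inv (W k) ** transpose (T k)"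
    and \<rho>: "\<forall>k<n. \<rho> k = Lv P k + Lbar P k
              + transpose ((Bm P k + Bbar P k)
                  - (Cm P k + Cbar P k) ** matrix_inv (W k) ** transpose (T k)) *v \<rho> (Suc k)"
    and chi_rec: "\<forall>k<n. chi k = chi (Suc k)
              - 1/4 * (\<rho> (Suc k) \<bullet>
                  (((Cm P k + Cbar P k) ** matrix_inv (W k) ** transpose (Cm P k + Cbar P k))
                    *v \<rho> (Suc k)))"
  shows "(\<forall>k\<in>{1..n}. pos_mat (V (k - 1)) \<and> invertible (V (k - 1))
                   \<and> pos_mat (W (k - 1)) \<and> invertible (W (k - 1))
                   \<and> nonneg_mat (\<Lambda> k) \<and> nonneg_mat (\<Gamma> k))
    \<and> (\<forall>k\<le>n. \<forall>\<mu>\<in>P2. value_fn P n k \<mu> =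
          ereal (Var \<mu> (\<Lambda> k) + mean \<mu> \<bullet> (\<Gamma> k *v mean \<mu>) + \<rho> k \<bullet> mean \<mu> + chi k))
    \<and> (\<exists>\<alpha>\<in>feedback_controls n.
          (\<forall>k<n. \<forall>\<omega>\<in>space M.
             \<alpha> k (state P M \<xi> \<epsilon> \<alpha> k \<omega>) =
               lq_feedback P k (V k) (W k) (S k) (T k) (\<rho> (Suc k))
                 (state P M \<xi> \<epsilon> \<alpha> k \<omega>) (\<integral>\<omega>'. state P M \<xi> \<epsilon> \<alpha> k \<omega>' \<partial>M))
          \<and> ereal (Jcost P n M \<xi> \<epsilon> \<alpha>) = (INF \<beta>\<in>feedback_controls n. ereal (Jcost P n M \<xi> \<epsilon> \<beta>)))"
proof -
  interpret lq_riccati P n V W S T \<Lambda> \<Gamma> \<rho> chi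
    by unfold_locales (fact assms)+
  let ?\<alpha> = "optimal_control (integral\<^sup>L M \<xi>)"
  have "pos_mat (V (k - 1)) \<and> invertible (V (k - 1)) \<and> pos_mat (W (k - 1))
      \<and> invertible (W (k - 1)) \<and> nonneg_mat (\<Lambda> k) \<and> nonneg_mat (\<Gamma> k)" if "k \<in> {1..n}" for k
    using that V_W[of "k - 1"] nonneg_\<Lambda>_\<Gamma>[of k] by auto
  moreover have "value_fn P n k \<mu>
      = ereal (Var \<mu> (\<Lambda> k) + mean \<mu> \<bullet> (\<Gamma> k *v mean \<mu>) + \<rho> k \<bullet> mean \<mu> + chi k)"
    if "k \<le> n" "\<mu> \<in> P2" for k \<mu>
    using that by (simp add: value_fn_def value_togo_eq val_def)
  \<comment> \<open>The predicted mean is replaced by the actual expectation, for every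
    \<open>x\<close> and hence along every path.\<close>
  moreover have "?\<alpha> k x = lq_feedback P k (V k) (W k) (S k) (T k) (\<rho> (Suc k)) x
      (\<integral>\<omega>. state P M \<xi> \<epsilon> ?\<alpha> k \<omega> \<partial>M)" if "k < n" for k x
    using that by (simp add: expectation_optimal_state[OF noise] optimal_control_def)
  ultimately show ?thesis
    using optimal_control_feedback optimal_control_minimizes[OF noise] by blast
qed

end
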